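(* Let $Q$ be a compact DJS-hypergroup with involution $p\mapsto p^\dagger$, comultiplication $\Delta:C(Q)\to C(Q)\otimes C(Q)$, neutral element $e$ and Haar measure $\mu$; let $Y$ be a compact Hausdorff space, and let $\phi:Q\to Y$ be an orbital mapping, i.e. an open continuous mapping of $Q$ onto $Y$. Let $B\subset C(Q)$ be the $C^*$-subalgebra of functions constant on $\phi$-orbits, and put $\tilde e=\phi(e)$. Consider the conditions: (a) $\phi^{-1}(\tilde e)=\{e\}$; (b) if $A$ is a $\phi$-orbit, then so is $A^\dagger$; (c) for any $y\in Y$ there exists a probability measure $q_y\in M(Q)$ such that $\mathrm{supp}\,q_y\subset\phi^{-1}(y)$; (d) each measure $q_y$ is $\phi$-consistent. Suppose (a)–(d) are satisfied, and define the linear mapping $P:C(Q)\to B$ by $$(Pf)(x)=\langle q_{\phi(x)},f\rangle .$$ Then $P$ is a conditional expectation and satisfies all of the following hypotheses, denoted (H): $P$ is $\mu$-invariant ($\mu\circ P=\mu$); $(P\otimes P)\Delta(f)=(P\otimes P)\Delta(Pf)$ for all $f\in C(Q)$; $P\circ\star=\star\circ P$, where $f^\star(x)=\overline{f(x^\dagger)}$; and, with $\tilde\Delta=(P\otimes P)\circ\Delta|_B$, the functional $\epsilon(f)=f(e)$ satisfies $(\epsilon\otimes \mathrm{id})\circ\tilde\Delta=(\mathrm{id}\otimes\epsilon)\circ\tilde\Delta=\mathrm{id}$ on $B$. Conversely, if (a)–(c) hold and the linear mapping $P$ defined by $(Pf)(x)=\langle q_{\phi(x)},f\rangle$ is a conditional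 expectation from $C(Q)$ to $B$ satisfying all hypotheses (H), then each $q_y$ is $\phi$-consistent.
   Context: A DJS-hypergroup is a hypergroup in the sense of Dunkl–Jewett–Spector; $M(Q)$ is the space of Radon measures on $Q$ with convolution $*$, $\delta_x$ is the point mass at $x$, $C(Q)\otimes C(Q)=C(Q\times Q)$, and $(\Delta f)(x,y)=\langle\delta_x*\delta_y,f\rangle$. The closed sets $\phi^{-1}(y)$, $y\in Y$, are called $\phi$-orbits. The mapping $\phi_*:M(Q)\to M(Y)$ is $\langle\phi_*(\nu),f\rangle=\langle\nu,f\circ\phi\rangle$ for $\nu\in M(Q)$, $f\in C(Y)$. A measure $m\in M(Q)$ is $\phi$-consistent if $\phi_*(m*\nu)=0=\phi_*(\nu*m)$ whenever $\nu\in M(Q)$ and $\phi_*(\nu)=0$. The hypergroup $Q$ is viewed as a compact quantum hypergroup on $C(Q)$ with $f^\star(x)=\overline{f(x^\dagger)}$, counit $\epsilon(f)=f(e)$, and trivial one-parameter group $\sigma_z=\mathrm{id}$. *)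

theory Defs
  imports "HOL-Analysis.Analysis"
begin

text \<open>
  Spaces are types: \<open>X\<close> is a type of class \<open>t2_space\<close> with \<open>compact (UNIV :: 'x set)\<close>.
  Elements of \<open>C(X)\<close> are plain functions in the carrier below. As \<open>X\<close> is compact, complex Radon
  measures are taken, as by Bourbaki, to be the bounded linear functionals on \<open>C(X)\<close>, so the
  pairing of \<open>\<nu>\<close> with \<open>f\<close> is the application \<open>\<nu> f\<close>. Functionals are only meaningful on
  \<open>C(X)\<close>, and equality of measures is always stated as agreement there.
\<close>

type_synonym 'x functional = "('x \<Rightarrow> complex) \<Rightarrow> complex"

definition cfun :: "('x::topological_space \<Rightarrow> complex) set"
  where "cfun = {f. continuous_on UNIV f}"

definition sup_norm :: "('x \<Rightarrow> complex) \<Rightarrow> real"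
  where "sup_norm f = (SUP x. cmod (f x))"

definition radon_measures :: "'x::topological_space functional set"
  where "radon_measures = {\<nu>.
    (\<forall>f\<in>cfun. \<forall>g\<in>cfun. \<nu> (\<lambda>x. f x + g x) = \<nu> f + \<nu> g) \<and>
    (\<forall>c. \<forall>f\<in>cfun. \<nu> (\<lambda>x. c * f x) = c * \<nu> f) \<and>
    (\<exists>K. \<forall>f\<in>cfun. cmod (\<nu> f) \<le> K * sup_norm f)}"

definition dirac :: "'x \<Rightarrow> 'x functional"
  where "dirac x = (\<lambda>f. f x)"

definition probability_measure :: "'x::topological_space functional \<Rightarrow> bool"
  where "probability_measure \<nu> \<longleftrightarrow> \<nu> \<in> radon_measures \<and>
    (\<forall>f\<in>cfun. (\<forall>x. f x \<in> \<real>\<^sub>\<ge>\<^sub>0) \<longrightarrow> \<nu> f \<in> \<real>\<^sub>\<ge>\<^sub>0) \<and> \<nu> (\<lambda>_. 1) = 1"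

text \<open>The complement of the union of all open sets on which \<open>\<nu>\<close> vanishes.\<close>

definition msupport :: "'x::topological_space functional \<Rightarrow> 'x set"
  where "msupport \<nu> =
    - \<Union> {U. open U \<and> (\<forall>f\<in>cfun. closure {x. f x \<noteq> 0} \<subseteq> U \<longrightarrow> \<nu> f = 0)}"

definition pushforward :: "('x \<Rightarrow> 'y) \<Rightarrow> 'x functional \<Rightarrow> 'y functional"
  where "pushforward \<phi> \<nu> = (\<lambda>f. \<nu> (f \<circ> \<phi>))"

definition zero_measure :: "'x::topological_space functional \<Rightarrow> bool"
  where "zero_measure \<nu> \<longleftrightarrow> (\<forall>f\<in>cfun. \<nu> f = 0)"


section \<open>Hypergroups\<close>

text \<open>
  Following Dunkl, a hypergroup is given by the measures \<open>pc x y\<close>, the convolutions of the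
  point masses at \<open>x\<close> and \<open>y\<close>; the convolution of arbitrary measures is obtained from them by
  integration. The remaining axioms are those of Jewett, for a compact space.
\<close>

definition comult :: "('q \<Rightarrow> 'q \<Rightarrow> 'q functional) \<Rightarrow> ('q \<Rightarrow> complex) \<Rightarrow> ('q \<times> 'q \<Rightarrow> complex)"
  where "comult pc f = (\<lambda>(x, y). pc x y f)"

definition conv ::
    "('q \<Rightarrow> 'q \<Rightarrow> 'q functional) \<Rightarrow> 'q functional \<Rightarrow> 'q functional \<Rightarrow> 'q functional"
  where "conv pc \<nu> m = (\<lambda>f. \<nu> (\<lambda>x. m (\<lambda>y. comult pc f (x, y))))"

definition michael_topology :: "'x::topological_space set topology"
  where "michael_topology = topology_generated_by
    {{A. compact A \<and> A \<noteq> {} \<and> A \<inter> U \<noteq> {} \<and> A \<subseteq> V} |U V. open U \<and> open V}"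

locale compact_DJS_hypergroup =
  fixes pc :: "'q::t2_space \<Rightarrow> 'q \<Rightarrow> 'q functional"
    and dag :: "'q \<Rightarrow> 'q"
    and e :: 'q
  assumes compact_space: "compact (UNIV :: 'q set)"
    and pc_prob: "probability_measure (pc x y)"
    and pc_continuous: "f \<in> cfun \<Longrightarrow> comult pc f \<in> cfun"
    and conv_assoc: "\<lbrakk>\<nu> \<in> radon_measures; m \<in> radon_measures; k \<in> radon_measures; f \<in> cfun\<rbrakk>
      \<Longrightarrow> conv pc (conv pc \<nu> m) k f = conv pc \<nu> (conv pc m k) f"
    and support_continuous:
      "continuous_map euclidean michael_topology (\<lambda>(x, y). msupport (pc x y))"
    and neutral_left: "f \<in> cfun \<Longrightarrow> pc e x f = dirac x f"
    and neutral_right: "f \<in> cfun \<Longrightarrow> pc x e f = dirac x f"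
    and dag_continuous: "continuous_on UNIV dag"
    and dag_dag: "dag (dag x) = x"
    and dag_pc: "f \<in> cfun \<Longrightarrow> pushforward dag (pc x y) f = pc (dag y) (dag x) f"
    and neutral_in_support: "e \<in> msupport (pc x y) \<longleftrightarrow> x = dag y"

definition haar_measure :: "('q::topological_space \<Rightarrow> 'q \<Rightarrow> 'q functional) \<Rightarrow> 'q functional \<Rightarrow> bool"
  where "haar_measure pc \<mu> \<longleftrightarrow> probability_measure \<mu> \<and>
    (\<forall>x. \<forall>f\<in>cfun. conv pc (dirac x) \<mu> f = \<mu> f)"


section \<open>Orbital mappings\<close>

definition orbital_mapping :: "('q::topological_space \<Rightarrow> 'y::topological_space) \<Rightarrow> bool"
  where "orbital_mapping \<phi> \<longleftrightarrow>
    continuous_on UNIV \<phi> \<and> (\<forall>U. open U \<longrightarrow> open (\<phi> ` U)) \<and> surj \<phi>"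

definition orbits :: "('q \<Rightarrow> 'y) \<Rightarrow> 'q set set"
  where "orbits \<phi> = {\<phi> -` {y} |y. True}"

definition orbit_subalgebra :: "('q::topological_space \<Rightarrow> 'y) \<Rightarrow> ('q \<Rightarrow> complex) set"
  where "orbit_subalgebra \<phi> = {f \<in> cfun. \<forall>A\<in>orbits \<phi>. f constant_on A}"

definition phi_consistent ::
    "('q::topological_space \<Rightarrow> 'q \<Rightarrow> 'q functional) \<Rightarrow> ('q \<Rightarrow> 'y::topological_space)
      \<Rightarrow> 'q functional \<Rightarrow> bool"
  where "phi_consistent pc \<phi> m \<longleftrightarrow> m \<in> radon_measures \<and>
    (\<forall>\<nu>\<in>radon_measures. zero_measure (pushforward \<phi> \<nu>) \<longrightarrow>
      zero_measure (pushforward \<phi> (conv pc m \<nu>)) \<and>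
      zero_measure (pushforward \<phi> (conv pc \<nu> m)))"


section \<open>Operators on algebras of continuous functions\<close>

definition linear_op ::
    "(('x::topological_space \<Rightarrow> complex) \<Rightarrow> ('z::topological_space \<Rightarrow> complex)) \<Rightarrow> bool"
  where "linear_op T \<longleftrightarrow> (\<forall>f\<in>cfun. T f \<in> cfun) \<and>
    (\<forall>f\<in>cfun. \<forall>g\<in>cfun. T (\<lambda>x. f x + g x) = (\<lambda>z. T f z + T g z)) \<and>
    (\<forall>c. \<forall>f\<in>cfun. T (\<lambda>x. c * f x) = (\<lambda>z. c * T f z))"

definition bounded_op ::
    "(('x::topological_space \<Rightarrow> complex) \<Rightarrow> ('z::topological_space \<Rightarrow> complex)) \<Rightarrow> bool"
  where "bounded_op T \<longleftrightarrow>
    linear_op T \<and> (\<exists>K. \<forall>f\<in>cfun. sup_norm (T f) \<le> K * sup_norm f)"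

text \<open>A positive linear projection of norm one onto \<open>B\<close> that is a \<open>B\<close>-bimodule map.\<close>

definition conditional_expectation ::
    "('x::topological_space \<Rightarrow> complex) set \<Rightarrow> (('x \<Rightarrow> complex) \<Rightarrow> ('x \<Rightarrow> complex)) \<Rightarrow> bool"
  where "conditional_expectation B P \<longleftrightarrow> linear_op P \<and>
    (\<forall>f\<in>cfun. P f \<in> B) \<and> (\<forall>b\<in>B. P b = b) \<and>
    (\<forall>f\<in>cfun. (\<forall>x. f x \<in> \<real>\<^sub>\<ge>\<^sub>0) \<longrightarrow> (\<forall>x. P f x \<in> \<real>\<^sub>\<ge>\<^sub>0)) \<and>
    (\<forall>f\<in>cfun. sup_norm (P f) \<le> sup_norm f) \<and>
    (\<forall>b\<in>B. \<forall>b'\<in>B. \<forall>f\<in>cfun. P (\<lambda>x. b x * f x * b' x) = (\<lambda>x. b x * P f x * b' x))"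

definition ptensor :: "('x \<Rightarrow> complex) \<Rightarrow> ('y \<Rightarrow> complex) \<Rightarrow> ('x \<times> 'y \<Rightarrow> complex)"
  where "ptensor f g = (\<lambda>(x, y). f x * g y)"

text \<open>
  With \<open>C(X) \<otimes> C(Y) = C(X \<times> Y)\<close>: the bounded linear map on \<open>C(X \<times> Y)\<close> that sends
  \<open>f \<otimes> g\<close> to \<open>\<beta> f g\<close>. By density of the algebraic tensor product there is at most one
  (extensionality makes it unique also as a function on all of \<open>'x \<times> 'y \<Rightarrow> complex\<close>).
\<close>

definition tensor_ext ::
    "(('x::topological_space \<Rightarrow> complex) \<Rightarrow> ('y::topological_space \<Rightarrow> complex)
        \<Rightarrow> ('z::topological_space \<Rightarrow> complex))
      \<Rightarrow> ('x \<times> 'y \<Rightarrow> complex) \<Rightarrow> ('z \<Rightarrow> complex)"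
  where "tensor_ext \<beta> = (THE T. T \<in> extensional cfun \<and> bounded_op T \<and>
    (\<forall>f\<in>cfun. \<forall>g\<in>cfun. T (ptensor f g) = \<beta> f g))"

definition op_tensor_op ::
    "(('x::topological_space \<Rightarrow> complex) \<Rightarrow> ('x \<Rightarrow> complex))
      \<Rightarrow> (('y::topological_space \<Rightarrow> complex) \<Rightarrow> ('y \<Rightarrow> complex))
      \<Rightarrow> ('x \<times> 'y \<Rightarrow> complex) \<Rightarrow> ('x \<times> 'y \<Rightarrow> complex)"
  where "op_tensor_op P R = tensor_ext (\<lambda>f g. ptensor (P f) (R g))"

definition fun_tensor_id ::
    "'x::topological_space functional \<Rightarrow> ('x \<times> 'y::topological_space \<Rightarrow> complex) \<Rightarrow> ('y \<Rightarrow> complex)"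
  where "fun_tensor_id \<omega> = tensor_ext (\<lambda>f g. (\<lambda>y. \<omega> f * g y))"

definition id_tensor_fun ::
    "'y::topological_space functional \<Rightarrow> ('x::topological_space \<times> 'y \<Rightarrow> complex) \<Rightarrow> ('x \<Rightarrow> complex)"
  where "id_tensor_fun \<omega> = tensor_ext (\<lambda>f g. (\<lambda>x. f x * \<omega> g))"

definition star :: "('q \<Rightarrow> 'q) \<Rightarrow> ('q \<Rightarrow> complex) \<Rightarrow> ('q \<Rightarrow> complex)"
  where "star dag f = (\<lambda>x. cnj (f (dag x)))"

text \<open>The counit \<open>\<epsilon>\<close> is \<open>dirac e\<close>.\<close>

definition hypotheses_H ::
    "('q::topological_space \<Rightarrow> 'q \<Rightarrow> 'q functional) \<Rightarrow> ('q \<Rightarrow> 'q) \<Rightarrow> 'q \<Rightarrow> 'q functional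
      \<Rightarrow> ('q \<Rightarrow> complex) set \<Rightarrow> (('q \<Rightarrow> complex) \<Rightarrow> ('q \<Rightarrow> complex)) \<Rightarrow> bool"
  where "hypotheses_H pc dag e \<mu> B P \<longleftrightarrow>
    (\<forall>f\<in>cfun. \<mu> (P f) = \<mu> f) \<and>
    (\<forall>f\<in>cfun. op_tensor_op P P (comult pc f) = op_tensor_op P P (comult pc (P f))) \<and>
    (\<forall>f\<in>cfun. P (star dag f) = star dag (P f)) \<and>
    (\<forall>f\<in>B. fun_tensor_id (dirac e) (op_tensor_op P P (comult pc f)) = f) \<and>
    (\<forall>f\<in>B. id_tensor_fun (dirac e) (op_tensor_op P P (comult pc f)) = f)"

end

theory Submission
  imports Defs
begin

text \<open>
  Write \<open>f (x * y)\<close> for the integral of \<open>f\<close> against the convolution of the point masses at \<open>x\<close>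
  and \<open>y\<close>, and \<open>B\<close> for the algebra of functions that are constant on orbits. A measure is null
  on the orbit space iff it annihilates \<open>B\<close>, so consistency is a statement on the functionals
  \<open>b \<mapsto> (m * \<nu>) b\<close> with \<open>b \<in> B\<close>.

  Both directions rest on approximate identities (\<open>approximate_identity\<close>). For a bump \<open>k\<close> at \<open>e\<close>
  of integral one, the kernel \<open>k (dag x * z)\<close> has total mass one by invariance of the Haar measure,
  and it lives near the diagonal since \<open>e\<close> is in the support of \<open>dag x * z\<close> only for \<open>x = z\<close>.
  Because the orbit of \<open>e\<close> is a point, \<open>k\<close> can be taken in \<open>B\<close>; hence the translates of functions in
  \<open>B\<close> determine every measure (\<open>zero_on_translates\<close>).

  If all \<open>q y\<close> are consistent, then in any convolution tested against \<open>B\<close> a point mass at \<open>x\<close> may be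
  exchanged for \<open>q (\<phi> x)\<close>, as long as the other factor is consistent. So the expectation of the
  translate \<open>v \<mapsto> k (x * v)\<close> is \<open>z \<mapsto> \<integral> k (u * z) dq(u)\<close> with \<open>q = q (\<phi> x)\<close> (\<open>q_translate\<close>).
  This is continuous in \<open>z\<close>, and by density the expectation of every continuous function is
  continuous (\<open>E_continuous\<close>). Invariance of the Haar measure and compatibility with the
  comultiplication are equalities of measures, which hold on translates of \<open>B\<close>. The same argument
  shows that a consistent measure is determined by its image in the orbit space; as the involution
  maps consistent measures to consistent ones, it permutes the \<open>q y\<close>, whence the compatibility
  with \<open>star\<close>. The counit conditions hold because \<open>q (\<phi> e)\<close> is the point mass at \<open>e\<close>, and the
  expectation is a \<open>B\<close>-linear projection onto \<open>B\<close> because each \<open>q y\<close> lives on the orbit over \<open>y\<close>.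

  Conversely, let \<open>P\<close> be the expectation. The measures \<open>b d\<mu>\<close> with \<open>b \<in> B\<close> are invariant under
  \<open>P\<close>, and so are their convolutions, by compatibility of \<open>P\<close> with the comultiplication
  (\<open>B_measures_conv_invariant\<close>). The adjoint of translation by \<open>x\<close> in \<open>L\<^sup>2(\<mu>)\<close> is translation by
  \<open>dag x\<close> (\<open>translation_adjoint\<close>), so \<open>y \<mapsto> \<integral> a(x) c(x * y) d\<mu>(x)\<close> is the density of such a
  convolution, and therefore lies in \<open>B\<close> when \<open>a\<close> and \<open>c\<close> do. A measure \<open>\<nu>\<close> that annihilates \<open>B\<close> thus
  annihilates this function; letting \<open>a\<close> range over the functions \<open>P f\<close> gives \<open>q y * \<nu> = 0\<close> on \<open>B\<close>.
  The product in the other order follows by applying the involution.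
\<close>

section \<open>Continuous functions and measures on compact spaces\<close>

lemma cfun_iff: "f \<in> cfun \<longleftrightarrow> continuous_on UNIV f"
  by (simp add: cfun_def)

lemma cfun_const: "(\<lambda>_. c) \<in> cfun"
  and cfun_add: "f \<in> cfun \<Longrightarrow> g \<in> cfun \<Longrightarrow> (\<lambda>x. f x + g x) \<in> cfun"
  and cfun_diff: "f \<in> cfun \<Longrightarrow> g \<in> cfun \<Longrightarrow> (\<lambda>x. f x - g x) \<in> cfun"
  and cfun_mult: "f \<in> cfun \<Longrightarrow> g \<in> cfun \<Longrightarrow> (\<lambda>x. f x * g x) \<in> cfun"
  and cfun_cnj: "f \<in> cfun \<Longrightarrow> (\<lambda>x. cnj (f x)) \<in> cfun"
  and cfun_of_real: "continuous_on UNIV h \<Longrightarrow> (\<lambda>x. complex_of_real (h x)) \<in> cfun"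
  unfolding cfun_iff
  by (simp_all add: continuous_on_const continuous_on_add continuous_on_diff continuous_on_mult
      continuous_on_cnj continuous_on_of_real)

lemmas cfun_intros = cfun_const cfun_add cfun_diff cfun_mult cfun_cnj cfun_of_real

lemma cfun_compose: "f \<in> cfun \<Longrightarrow> continuous_on UNIV h \<Longrightarrow> (\<lambda>x. f (h x)) \<in> cfun"
  unfolding cfun_iff by (rule continuous_on_compose2[where t = UNIV]) auto

lemma cfun_slice_left: "F \<in> cfun \<Longrightarrow> (\<lambda>u. F (u, v)) \<in> cfun"
  by (erule cfun_compose) (intro continuous_intros)

lemma cfun_slice_right: "F \<in> cfun \<Longrightarrow> (\<lambda>v. F (u, v)) \<in> cfun"
  by (erule cfun_compose) (intro continuous_intros)

lemma cfun_swap: "F \<in> cfun \<Longrightarrow> (\<lambda>p. F (snd p, fst p)) \<in> cfun"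
  by (erule cfun_compose) (intro continuous_intros)

lemma ptensor_cfun: "f \<in> cfun \<Longrightarrow> g \<in> cfun \<Longrightarrow> ptensor f g \<in> cfun"
  unfolding ptensor_def case_prod_unfold
  by (rule cfun_mult[OF cfun_compose[of f fst] cfun_compose[of g snd]])
    (simp_all add: continuous_on_fst continuous_on_snd)

text \<open>The domain has no metric, so continuity estimates are made on neighbourhoods.\<close>

lemma cfun_neighbourhoodI:
  assumes "\<And>p \<epsilon>. \<epsilon> > 0 \<Longrightarrow> \<exists>W. open W \<and> p \<in> W \<and> (\<forall>w\<in>W. cmod (f w - f p) < \<epsilon>)"
  shows "f \<in> cfun"
  unfolding cfun_iff continuous_on_def
proof (intro ballI tendstoI)
  fix p and \<epsilon> :: real assume "\<epsilon> > 0"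
  then obtain W where "open W" "p \<in> W" "\<forall>w\<in>W. cmod (f w - f p) < \<epsilon>"
    using assms by blast
  then show "\<forall>\<^sub>F w in at p. dist (f w) (f p) < \<epsilon>"
    unfolding eventually_at_topological dist_norm by blast
qed

lemma cfun_neighbourhood:
  assumes "f \<in> cfun" "\<epsilon> > 0"
  obtains W where "open W" "p \<in> W" "\<And>w. w \<in> W \<Longrightarrow> cmod (f w - f p) < \<epsilon>"
proof
  show "open (f -` ball (f p) \<epsilon>)"
    using assms(1) open_vimage[OF open_ball] by (auto simp: cfun_iff)
qed (use assms in \<open>auto simp: dist_norm norm_minus_commute\<close>)

lemma cfun_uniform_limit:
  assumes "\<And>\<epsilon>. \<epsilon> > 0 \<Longrightarrow> \<exists>g\<in>cfun. \<forall>x. cmod (f x - g x) \<le> \<epsilon>"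
  shows "f \<in> cfun"
proof (rule cfun_neighbourhoodI)
  fix p and \<epsilon> :: real assume "\<epsilon> > 0"
  then have "\<epsilon> / 3 > 0" by simp
  then obtain g where g: "g \<in> cfun" "\<And>x. cmod (f x - g x) \<le> \<epsilon> / 3"
    using assms by blast
  obtain W where W: "open W" "p \<in> W" "\<And>w. w \<in> W \<Longrightarrow> cmod (g w - g p) < \<epsilon> / 3"
    using cfun_neighbourhood[OF g(1) \<open>\<epsilon> / 3 > 0\<close>] by metis
  have "cmod (f w - f p) < \<epsilon>" if "w \<in> W" for w
  proof -
    have "cmod (f w - f p) \<le> cmod (f w - g w) + cmod (g w - g p) + cmod (f p - g p)"
      using norm_triangle_ineq[of "f w - g w + (g w - g p)" "g p - f p"]
        norm_triangle_ineq[of "f w - g w" "g w - g p"] by (simp add: norm_minus_commute)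
    then show ?thesis using g(2)[of w] g(2)[of p] W(3)[OF that] by linarith
  qed
  then show "\<exists>W. open W \<and> p \<in> W \<and> (\<forall>w\<in>W. cmod (f w - f p) < \<epsilon>)"
    using W by blast
qed

lemma uniform_slice:
  fixes F :: "'x::topological_space \<times> 'v::topological_space \<Rightarrow> complex"
  assumes X: "compact (UNIV :: 'x set)" and F: "F \<in> cfun" and "\<epsilon> > 0"
  obtains V where "open V" "v \<in> V" "\<And>v' u. v' \<in> V \<Longrightarrow> cmod (F (u, v') - F (u, v)) \<le> \<epsilon>"
proof -
  have "continuous_on (UNIV \<times> UNIV) (\<lambda>p. F (snd p, fst p))"
    using cfun_swap[OF F] by (simp add: cfun_iff)
  from continuous_on_prod_compactE[OF this X UNIV_I \<open>\<epsilon> > 0\<close>, of v]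
  obtain V where V: "v \<in> V" "open V"
    "\<forall>v'\<in>V \<inter> UNIV. \<forall>u\<in>UNIV. dist (F (snd (v', u), fst (v', u))) (F (snd (v, u), fst (v, u))) \<le> \<epsilon>" .
  show ?thesis
    by (rule that[OF V(2,1)]) (use V(3) in \<open>simp add: dist_norm\<close>)
qed

lemma cfun_bounded:
  fixes f :: "'x::topological_space \<Rightarrow> complex"
  assumes "compact (UNIV :: 'x set)" "f \<in> cfun"
  obtains c where "c \<ge> 0" "\<And>x. cmod (f x) \<le> c"
proof -
  have "bounded (range f)"
    using assms by (auto simp: cfun_iff intro: compact_imp_bounded compact_continuous_image)
  then obtain c where c: "\<And>x. cmod (f x) \<le> c"
    unfolding bounded_iff by blast
  show ?thesis
    using that[of c] c norm_ge_zero[of "f undefined"] order_trans by blast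
qed

lemma cmod_le_sup_norm:
  fixes f :: "'x::topological_space \<Rightarrow> complex"
  assumes "compact (UNIV :: 'x set)" "f \<in> cfun"
  shows "cmod (f x) \<le> sup_norm f"
proof -
  obtain c where "\<And>x. cmod (f x) \<le> c"
    using cfun_bounded[OF assms] by metis
  then have "bdd_above (range (\<lambda>x. cmod (f x)))"
    by (auto simp: bdd_above_def)
  then show ?thesis
    unfolding sup_norm_def by (rule cSUP_upper[OF UNIV_I])
qed

lemma sup_norm_le: "(\<And>x. cmod (f x) \<le> c) \<Longrightarrow> sup_norm f \<le> c"
  unfolding sup_norm_def by (rule cSUP_least) auto

text \<open>
  In this form, with an arbitrary bound \<open>c\<close> of \<open>f\<close>, estimates of iterated integrals compose
  without computing the supremum norm of the inner integral.
\<close>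

lemma radon_bound:
  fixes \<nu> :: "'x::topological_space functional"
  assumes "compact (UNIV :: 'x set)" "\<nu> \<in> radon_measures"
  obtains K where "K \<ge> 0" "\<And>f c. f \<in> cfun \<Longrightarrow> (\<And>x. cmod (f x) \<le> c) \<Longrightarrow> cmod (\<nu> f) \<le> K * c"
proof -
  obtain K where K: "\<And>f. f \<in> cfun \<Longrightarrow> cmod (\<nu> f) \<le> K * sup_norm f"
    using assms(2) unfolding radon_measures_def by blast
  show ?thesis
  proof
    fix f :: "'x \<Rightarrow> complex" and c
    assume f: "f \<in> cfun" and c: "\<And>x. cmod (f x) \<le> c"
    have "0 \<le> sup_norm f"
      using cmod_le_sup_norm[OF assms(1) f] norm_ge_zero order_trans by blast
    have "cmod (\<nu> f) \<le> K * sup_norm f" by (rule K[OF f])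
    also have "\<dots> \<le> \<bar>K\<bar> * sup_norm f"
      using \<open>0 \<le> sup_norm f\<close> by (simp add: mult_right_mono)
    also have "\<dots> \<le> \<bar>K\<bar> * c"
      using sup_norm_le[of f c] c by (simp add: mult_left_mono)
    finally show "cmod (\<nu> f) \<le> \<bar>K\<bar> * c" .
  qed simp
qed

lemma radonI:
  fixes \<nu> :: "'x::topological_space functional"
  assumes "compact (UNIV :: 'x set)"
    and "\<And>f g. f \<in> cfun \<Longrightarrow> g \<in> cfun \<Longrightarrow> \<nu> (\<lambda>x. f x + g x) = \<nu> f + \<nu> g"
    and "\<And>c f. f \<in> cfun \<Longrightarrow> \<nu> (\<lambda>x. c * f x) = c * \<nu> f"
    and "\<And>f c. f \<in> cfun \<Longrightarrow> (\<And>x. cmod (f x) \<le> c) \<Longrightarrow> cmod (\<nu> f) \<le> K * c"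
  shows "\<nu> \<in> radon_measures"
proof -
  have "cmod (\<nu> f) \<le> K * sup_norm f" if "f \<in> cfun" for f
    by (rule assms(4)[OF that cmod_le_sup_norm[OF assms(1) that]])
  then show ?thesis
    unfolding radon_measures_def using assms(2,3) by blast
qed

lemma radon_add:
  "\<nu> \<in> radon_measures \<Longrightarrow> f \<in> cfun \<Longrightarrow> g \<in> cfun \<Longrightarrow> \<nu> (\<lambda>x. f x + g x) = \<nu> f + \<nu> g"
  and radon_scale: "\<nu> \<in> radon_measures \<Longrightarrow> f \<in> cfun \<Longrightarrow> \<nu> (\<lambda>x. c * f x) = c * \<nu> f"
  by (auto simp: radon_measures_def)

lemma radon_scale_right:
  "\<nu> \<in> radon_measures \<Longrightarrow> f \<in> cfun \<Longrightarrow> \<nu> (\<lambda>x. f x * c) = \<nu> f * c"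
  using radon_scale[of \<nu> f c] by (simp add: mult.commute)

lemma radon_zero: "\<nu> \<in> radon_measures \<Longrightarrow> \<nu> (\<lambda>_. 0) = 0"
  using radon_scale[of \<nu> "\<lambda>_. 0" 0] by (simp add: cfun_const)

lemma radon_diff:
  assumes "\<nu> \<in> radon_measures" "f \<in> cfun" "g \<in> cfun"
  shows "\<nu> (\<lambda>x. f x - g x) = \<nu> f - \<nu> g"
  using radon_add[OF assms(1,2), of "\<lambda>x. -1 * g x"] radon_scale[OF assms(1,3), of "-1"] assms(3)
    cfun_mult[OF cfun_const[of "-1"] assms(3)]
  by simp

lemma radon_diff_measure:
  fixes \<nu> m :: "'x::topological_space functional"
  assumes "compact (UNIV :: 'x set)" "\<nu> \<in> radon_measures" "m \<in> radon_measures"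
  shows "(\<lambda>f. \<nu> f - m f) \<in> radon_measures"
proof -
  obtain K where K: "\<And>f c. f \<in> cfun \<Longrightarrow> (\<And>x. cmod (f x) \<le> c) \<Longrightarrow> cmod (\<nu> f) \<le> K * c"
    using radon_bound[OF assms(1,2)] by metis
  obtain L where L: "\<And>f c. f \<in> cfun \<Longrightarrow> (\<And>x. cmod (f x) \<le> c) \<Longrightarrow> cmod (m f) \<le> L * c"
    using radon_bound[OF assms(1,3)] by metis
  show ?thesis
  proof (rule radonI[OF assms(1), where K = "K + L"])
    fix f :: "'x \<Rightarrow> complex" and c assume *: "f \<in> cfun" "\<And>x. cmod (f x) \<le> c"
    show "cmod (\<nu> f - m f) \<le> (K + L) * c"
      using K[OF *] L[OF *] norm_triangle_ineq4[of "\<nu> f" "m f"] by (simp add: distrib_right)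
  qed (simp_all add: radon_add[OF assms(2)] radon_add[OF assms(3)]
      radon_scale[OF assms(2)] radon_scale[OF assms(3)] algebra_simps)
qed

lemma radon_eqI:
  fixes \<nu> :: "'x::topological_space functional"
  assumes "compact (UNIV :: 'x set)" "\<nu> \<in> radon_measures" "f \<in> cfun"
    and approx: "\<And>\<epsilon>. \<epsilon> > 0 \<Longrightarrow> \<exists>g\<in>cfun. \<nu> g = 0 \<and> (\<forall>x. cmod (f x - g x) \<le> \<epsilon>)"
  shows "\<nu> f = 0"
proof -
  obtain K where K: "K \<ge> 0" "\<And>f c. f \<in> cfun \<Longrightarrow> (\<And>x. cmod (f x) \<le> c) \<Longrightarrow> cmod (\<nu> f) \<le> K * c"
    using radon_bound[OF assms(1,2)] by metis
  have "cmod (\<nu> f) \<le> 0 + \<epsilon>" if "\<epsilon> > 0" for \<epsilon>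
  proof -
    have "\<epsilon> / (K + 1) > 0" using that K(1) by simp
    then obtain g where g: "g \<in> cfun" "\<nu> g = 0" "\<And>x. cmod (f x - g x) \<le> \<epsilon> / (K + 1)"
      using approx by blast
    have "cmod (\<nu> f) = cmod (\<nu> (\<lambda>x. f x - g x))"
      using radon_diff[OF assms(2,3) g(1)] g(2) by simp
    also have "\<dots> \<le> K * (\<epsilon> / (K + 1))"
      by (intro K(2) cfun_diff assms g)
    also have "\<dots> \<le> \<epsilon>"
      using K(1) that by (simp add: field_simps)
    finally show ?thesis by simp
  qed
  then show ?thesis
    using field_le_epsilon[of "cmod (\<nu> f)" 0] by simp
qed

lemma probability_radon: "probability_measure \<nu> \<Longrightarrow> \<nu> \<in> radon_measures"
  by (simp add: probability_measure_def)

lemma probability_const: "probability_measure \<nu> \<Longrightarrow> \<nu> (\<lambda>_. c) = c"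
  using radon_scale[OF probability_radon, of \<nu> "\<lambda>_. 1" c]
  by (simp add: cfun_const probability_measure_def)

context
  fixes \<nu> :: "'x::topological_space functional"
  assumes compact_X: "compact (UNIV :: 'x set)" and prob: "probability_measure \<nu>"
begin

lemma probability_nonneg:
  assumes "continuous_on UNIV h" "\<And>x. h x \<ge> (0::real)"
  shows "Re (\<nu> (\<lambda>x. of_real (h x))) \<ge> 0" "Im (\<nu> (\<lambda>x. of_real (h x))) = 0"
proof -
  have "\<nu> (\<lambda>x. of_real (h x)) \<in> \<real>\<^sub>\<ge>\<^sub>0"
    using prob assms(2) cfun_of_real[OF assms(1)] by (simp add: probability_measure_def)
  then show "Re (\<nu> (\<lambda>x. of_real (h x))) \<ge> 0" "Im (\<nu> (\<lambda>x. of_real (h x))) = 0"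
    by (auto simp: complex_nonneg_Reals_iff)
qed

lemma probability_real:
  assumes "continuous_on UNIV h"
  shows "Im (\<nu> (\<lambda>x. of_real (h x :: real))) = 0"
proof -
  obtain c where c: "\<And>x. cmod (of_real (h x)) \<le> c"
    using cfun_bounded[OF compact_X cfun_of_real[OF assms]] by metis
  have "h x + c \<ge> 0" for x using c[of x] by simp
  then have "Im (\<nu> (\<lambda>x. of_real (h x + c))) = 0"
    by (intro probability_nonneg continuous_intros assms)
  moreover have "\<nu> (\<lambda>x. of_real (h x + c)) = \<nu> (\<lambda>x. of_real (h x)) + of_real c"
    using radon_add[OF probability_radon[OF prob] cfun_of_real[OF assms] cfun_const[of "of_real c"]]
      probability_const[OF prob] by simp
  ultimately show ?thesis by simp
qed

text \<open>
  Positivity concerns real functions; the next two lemmas reduce a complex integral to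
  its real and imaginary part.
\<close>

lemma probability_Re_Im:
  assumes "f \<in> cfun"
  shows "\<nu> f = \<nu> (\<lambda>x. of_real (Re (f x))) + \<i> * \<nu> (\<lambda>x. of_real (Im (f x)))"
proof -
  have R: "(\<lambda>x. of_real (Re (f x))) \<in> cfun" and I: "(\<lambda>x. of_real (Im (f x))) \<in> cfun"
    using assms by (auto simp: cfun_iff intro!: continuous_intros)
  have "\<nu> f = \<nu> (\<lambda>x. of_real (Re (f x)) + \<i> * of_real (Im (f x)))"
    by (simp flip: complex_eq)
  also have "\<dots> = \<nu> (\<lambda>x. of_real (Re (f x))) + \<nu> (\<lambda>x. \<i> * of_real (Im (f x)))"
    by (rule radon_add[OF probability_radon[OF prob] R cfun_mult[OF cfun_const I]])
  finally show ?thesis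
    by (simp add: radon_scale[OF probability_radon[OF prob] I])
qed

lemma probability_Re:
  assumes "f \<in> cfun"
  shows "Re (\<nu> f) = Re (\<nu> (\<lambda>x. of_real (Re (f x))))"
    and "Im (\<nu> f) = Re (\<nu> (\<lambda>x. of_real (Im (f x))))"
proof -
  have "Im (\<nu> (\<lambda>x. of_real (Re (f x)))) = 0" "Im (\<nu> (\<lambda>x. of_real (Im (f x)))) = 0"
    by (intro probability_real, use assms in \<open>auto simp: cfun_iff intro!: continuous_intros\<close>)+
  then show "Re (\<nu> f) = Re (\<nu> (\<lambda>x. of_real (Re (f x))))"
    and "Im (\<nu> f) = Re (\<nu> (\<lambda>x. of_real (Im (f x))))"
    by (subst probability_Re_Im[OF assms]; simp)+
qed

lemma probability_cnj:
  assumes "f \<in> cfun"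
  shows "\<nu> (\<lambda>x. cnj (f x)) = cnj (\<nu> f)"
proof (rule complex_eqI)
  have "(\<lambda>x. of_real (Im (f x))) \<in> cfun"
    using assms by (auto simp: cfun_iff intro!: continuous_intros)
  then have "\<nu> (\<lambda>x. of_real (- Im (f x))) = - \<nu> (\<lambda>x. of_real (Im (f x)))"
    using radon_scale[OF probability_radon[OF prob], of "\<lambda>x. of_real (Im (f x))" "-1"] by simp
  then show "Im (\<nu> (\<lambda>x. cnj (f x))) = Im (cnj (\<nu> f))"
    by (simp add: probability_Re[OF assms] probability_Re[OF cfun_cnj[OF assms]])
qed (simp add: probability_Re[OF assms] probability_Re[OF cfun_cnj[OF assms]])

text \<open>Rotate: choose the phase \<open>w\<close> with \<open>w * \<nu> f = \<bar>\<nu> f\<bar>\<close> and compare real parts.\<close>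

lemma probability_dominated:
  assumes f: "f \<in> cfun" and h: "continuous_on UNIV h" and le: "\<And>x. cmod (f x) \<le> h x"
  shows "cmod (\<nu> f) \<le> Re (\<nu> (\<lambda>x. of_real (h x)))"
proof -
  obtain w where w: "cmod w = 1" "w * \<nu> f = of_real (cmod (\<nu> f))"
  proof (cases "\<nu> f = 0")
    case False
    show ?thesis
    proof
      show "cnj (sgn (\<nu> f)) * \<nu> f = of_real (cmod (\<nu> f))"
        using False complex_norm_square[of "\<nu> f"]
        by (simp add: sgn_div_norm scaleR_conv_of_real power2_eq_square field_simps)
    qed (use False in \<open>simp add: norm_sgn\<close>)
  qed (use that[of 1] in auto)
  have wf: "(\<lambda>x. w * f x) \<in> cfun" by (intro cfun_intros f)
  have R: "continuous_on UNIV (\<lambda>x. Re (w * f x))"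
    using wf unfolding cfun_iff by (rule continuous_on_Re)
  have "Re (w * f x) \<le> h x" for x
    using complex_Re_le_cmod[of "w * f x"] le[of x] w(1) by (simp add: norm_mult)
  then have "0 \<le> Re (\<nu> (\<lambda>x. of_real (h x - Re (w * f x))))"
    by (intro probability_nonneg continuous_intros h R) simp
  also have "\<nu> (\<lambda>x. of_real (h x - Re (w * f x)))
      = \<nu> (\<lambda>x. of_real (h x)) - \<nu> (\<lambda>x. of_real (Re (w * f x)))"
    using radon_diff[OF probability_radon[OF prob] cfun_of_real[OF h] cfun_of_real[OF R]]
    by (simp only: of_real_diff)
  finally have "Re (\<nu> (\<lambda>x. w * f x)) \<le> Re (\<nu> (\<lambda>x. of_real (h x)))"
    using probability_Re(1)[OF wf] by simp
  moreover have "\<nu> (\<lambda>x. w * f x) = of_real (cmod (\<nu> f))"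
    using radon_scale[OF probability_radon[OF prob] f, of w] w(2) by simp
  ultimately show ?thesis by simp
qed

lemma probability_bound:
  assumes "f \<in> cfun" "\<And>x. cmod (f x) \<le> c"
  shows "cmod (\<nu> f) \<le> c"
  using probability_dominated[OF assms(1), of "\<lambda>_. c"] assms(2) probability_const[OF prob]
  by simp

lemma probability_close:
  assumes f: "f \<in> cfun" and g: "g \<in> cfun" and "\<And>x. cmod (f x - g x) \<le> c"
  shows "cmod (\<nu> f - \<nu> g) \<le> c"
  using probability_bound[OF cfun_diff[OF f g]] assms(3)
  by (simp add: radon_diff[OF probability_radon[OF prob] f g])

end

lemma cmod_eq_0_by_bounds:
  assumes "\<And>\<epsilon>. \<epsilon> > 0 \<Longrightarrow> cmod z \<le> \<epsilon>"
  shows "z = 0"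
  using field_le_epsilon[of "cmod z" 0] assms by simp

section \<open>Supports of probability measures\<close>

lemma urysohn:
  fixes S T :: "'x::t2_space set"
  assumes "compact (UNIV :: 'x set)" "closed S" "closed T" "S \<inter> T = {}"
  obtains h where "continuous_on UNIV h" "\<And>x. 0 \<le> h x" "\<And>x. h x \<le> (1::real)"
    "\<And>x. x \<in> S \<Longrightarrow> h x = 1" "\<And>x. x \<in> T \<Longrightarrow> h x = 0"
proof -
  have "Hausdorff_space (euclidean :: 'x topology)"
    using hausdorff unfolding Hausdorff_space_def disjnt_def by auto
  moreover have "compact_space (euclidean :: 'x topology)"
    using assms(1) by (simp add: compact_space_def)
  ultimately have normal: "normal_space (euclidean :: 'x topology)"
    using compact_Hausdorff_or_regular_imp_normal_space by blast
  have "closedin euclidean T" "closedin euclidean S" "disjnt T S"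
    using assms by (auto simp: disjnt_def)
  from Urysohn_lemma[OF normal this zero_le_one[where 'a = real]]
  obtain h where h: "continuous_map euclidean (top_of_set {0..1::real}) h"
    "h ` T \<subseteq> {0}" "h ` S \<subseteq> {1}" by metis
  then have "continuous_on UNIV h" "range h \<subseteq> {0..1}"
    by (auto simp: continuous_map_in_subtopology)
  with h have "0 \<le> h x" "h x \<le> 1" for x by (auto dest: subsetD[OF _ rangeI])
  with h \<open>continuous_on UNIV h\<close> show ?thesis
    by (intro that[of h]) auto
qed

lemma cfun_sum: "(\<And>i. i \<in> I \<Longrightarrow> f i \<in> cfun) \<Longrightarrow> (\<lambda>x. \<Sum>i\<in>I. f i x) \<in> cfun"
  unfolding cfun_iff by (rule continuous_on_sum)

lemma radon_sum:
  assumes "\<nu> \<in> radon_measures" "finite I" "\<And>i. i \<in> I \<Longrightarrow> f i \<in> cfun"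
  shows "\<nu> (\<lambda>x. \<Sum>i\<in>I. f i x) = (\<Sum>i\<in>I. \<nu> (f i))"
  using assms(2,3)
proof (induction I)
  case (insert i I)
  then show ?case
    using radon_add[OF assms(1), of "f i" "\<lambda>x. \<Sum>i\<in>I. f i x"] cfun_sum[of I f] by simp
qed (simp add: radon_zero[OF assms(1)])

lemma compact_positive_minimum:
  assumes "compact C" "continuous_on UNIV k" "\<And>x. x \<in> C \<Longrightarrow> k x > (0::real)"
  obtains \<delta> where "\<delta> > 0" "\<And>x. x \<in> C \<Longrightarrow> \<delta> \<le> k x"
proof (cases "C = {}")
  case False
  obtain x where "x \<in> C" "\<And>y. y \<in> C \<Longrightarrow> k x \<le> k y"
    using continuous_attains_inf[OF assms(1) False continuous_on_subset[OF assms(2)]] by auto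
  then show ?thesis using that[of "k x"] assms(3) by simp
qed (use that[of 1] in auto)

lemma open_positive:
  "continuous_on UNIV k \<Longrightarrow> open {x. k x > (0::real)}"
  by (rule open_Collect_less) (auto intro: continuous_intros)

context
  fixes \<nu> :: "'x::t2_space functional"
  assumes compact_X: "compact (UNIV :: 'x set)" and prob: "probability_measure \<nu>"
begin

text \<open>On \<open>C\<close> the function \<open>f\<close> is dominated by a multiple of the null function \<open>k\<close>.\<close>

lemma probability_le_off_null:
  assumes k: "continuous_on UNIV k" "\<And>x. k x \<ge> (0::real)" "Re (\<nu> (\<lambda>x. of_real (k x))) = 0"
    and C: "compact C" "\<And>x. x \<in> C \<Longrightarrow> k x > 0"
    and f: "f \<in> cfun" and small: "\<And>x. x \<notin> C \<Longrightarrow> cmod (f x) \<le> \<epsilon>" and "\<epsilon> \<ge> 0"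
  shows "cmod (\<nu> f) \<le> \<epsilon>"
proof -
  obtain \<delta> where \<delta>: "\<delta> > 0" "\<And>x. x \<in> C \<Longrightarrow> \<delta> \<le> k x"
    using compact_positive_minimum[OF C(1) k(1) C(2)] by metis
  obtain c where c: "c \<ge> 0" "\<And>x. cmod (f x) \<le> c"
    using cfun_bounded[OF compact_X f] by metis
  have "cmod (f x) \<le> \<epsilon> + c / \<delta> * k x" for x
  proof (cases "x \<in> C")
    case True
    have "c = c / \<delta> * \<delta>" using \<delta>(1) by simp
    also have "\<dots> \<le> c / \<delta> * k x" using \<delta> True c(1) by (intro mult_left_mono) auto
    finally show ?thesis using c(2)[of x] \<open>\<epsilon> \<ge> 0\<close> by linarith
  next
    case False
    have "0 \<le> c / \<delta> * k x" using \<delta>(1) c(1) k(2) by simp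
    then show ?thesis using small[OF False] by linarith
  qed
  then have "cmod (\<nu> f) \<le> Re (\<nu> (\<lambda>x. of_real (\<epsilon> + c / \<delta> * k x)))"
    by (intro probability_dominated[OF compact_X prob f] continuous_intros k)
  also have "\<nu> (\<lambda>x. of_real (\<epsilon> + c / \<delta> * k x)) = of_real \<epsilon> + of_real (c / \<delta>) * \<nu> (\<lambda>x. of_real (k x))"
    using radon_add[OF probability_radon[OF prob] cfun_const
        cfun_mult[OF cfun_const cfun_of_real[OF k(1)]], of "of_real \<epsilon>" "of_real (c / \<delta>)"]
      radon_scale[OF probability_radon[OF prob] cfun_of_real[OF k(1)], of "of_real (c / \<delta>)"]
      probability_const[OF prob] by simp
  finally show ?thesis using k(3) by simp
qed

text \<open>
  The set where \<open>\<bar>f\<bar> \<ge> \<epsilon>\<close> is compact and avoids the support, hence is covered by finitely many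
  open null sets; the sum of null functions that are positive on them dominates \<open>f\<close> there.
\<close>

lemma probability_zero_on_support:
  assumes f: "f \<in> cfun" and zero: "\<And>x. x \<in> msupport \<nu> \<Longrightarrow> f x = 0"
  shows "\<nu> f = 0"
proof (rule cmod_eq_0_by_bounds)
  fix \<epsilon> :: real assume "\<epsilon> > 0"
  define C where "C = {x. \<epsilon> \<le> cmod (f x)}"
  have "closed C"
    unfolding C_def using f by (auto simp: cfun_iff intro!: closed_Collect_le continuous_intros)
  then have C: "compact C"
    using compact_X compact_Int_closed[of UNIV C] by simp
  have "\<exists>g. continuous_on UNIV g \<and> (\<forall>y. g y \<ge> (0::real)) \<and> \<nu> (\<lambda>y. of_real (g y)) = 0 \<and> g x > 0"
    if "x \<in> C" for x
  proof -
    have "x \<notin> msupport \<nu>" using zero[of x] that \<open>\<epsilon> > 0\<close> by (auto simp: C_def)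
    then obtain U where U: "open U" "x \<in> U"
      "\<And>g. g \<in> cfun \<Longrightarrow> closure {y. g y \<noteq> 0} \<subseteq> U \<Longrightarrow> \<nu> g = 0"
      by (auto simp: msupport_def)
    obtain h where h: "continuous_on UNIV h" "\<And>y. h y \<le> (1::real)" "h x = 1"
      "\<And>y. y \<in> - U \<Longrightarrow> h y = 0"
      using urysohn[OF compact_X closed_singleton[of x], of "- U"] U(1,2) by (metis
        Compl_iff Int_insert_left_if0 closed_Compl inf_bot_left singletonI)
    \<comment> \<open>\<open>h\<close> vanishes off \<open>U\<close>, but its support may leave \<open>U\<close>; cutting it at height one half
      keeps the closed support inside.\<close>
    define g where "g y = max 0 (h y - 1/2)" for y
    have g: "continuous_on UNIV g" unfolding g_def by (intro continuous_intros h)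
    have "closure {y. complex_of_real (g y) \<noteq> 0} \<subseteq> {y. 1/2 \<le> h y}"
      by (rule closure_minimal) (auto simp: g_def max_def split: if_splits
          intro!: closed_Collect_le continuous_intros h)
    also have "\<dots> \<subseteq> U" using h(4) by fastforce
    finally have "\<nu> (\<lambda>y. of_real (g y)) = 0"
      by (intro U(3) cfun_of_real g)
    with g show ?thesis
      by (intro exI[of _ g]) (auto simp: g_def h)
  qed
  then obtain g where g: "\<And>x. x \<in> C \<Longrightarrow> continuous_on UNIV (g x)"
    "\<And>x y. x \<in> C \<Longrightarrow> g x y \<ge> (0::real)"
    "\<And>x. x \<in> C \<Longrightarrow> \<nu> (\<lambda>y. of_real (g x y)) = 0" "\<And>x. x \<in> C \<Longrightarrow> g x x > 0"
    by metis
  obtain D where D: "D \<subseteq> C" "finite D" "C \<subseteq> (\<Union>x\<in>D. {y. g x y > 0})"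
    using compactE_image[OF C, of C "\<lambda>x. {y. g x y > 0}"] g(1,4) open_positive by blast
  define k where "k y = (\<Sum>x\<in>D. g x y)" for y
  have k: "continuous_on UNIV k"
    unfolding k_def using D(1) g(1) by (intro continuous_intros) auto
  have k_nonneg: "k y \<ge> 0" for y
    unfolding k_def using D(1) g(2) by (intro sum_nonneg) auto
  have k_pos: "k y > 0" if y: "y \<in> C" for y
  proof -
    obtain x where "x \<in> D" "g x y > 0" using D(3) y by blast
    then show ?thesis
      unfolding k_def using D(1,2) g(2) by (intro sum_pos2[of D x]) auto
  qed
  have "\<nu> (\<lambda>y. of_real (k y)) = (\<Sum>x\<in>D. \<nu> (\<lambda>y. of_real (g x y)))"
    unfolding k_def of_real_sum
    using D g(1) by (intro radon_sum probability_radon prob cfun_of_real) auto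
  also have "\<dots> = 0" using D(1) g(3) by (auto intro: sum.neutral)
  finally show "cmod (\<nu> f) \<le> \<epsilon>"
    using \<open>\<epsilon> > 0\<close>
    by (intro probability_le_off_null[OF k k_nonneg _ C k_pos f]) (auto simp: C_def)
qed

lemma probability_const_on_support:
  assumes f: "f \<in> cfun" and const: "\<And>x. x \<in> msupport \<nu> \<Longrightarrow> f x = c"
  shows "\<nu> f = c"
proof -
  have "\<nu> (\<lambda>x. f x - c) = 0"
    by (rule probability_zero_on_support) (auto intro!: cfun_intros f simp: const)
  then show ?thesis
    using radon_diff[OF probability_radon[OF prob] f cfun_const] probability_const[OF prob]
    by simp
qed

text \<open>Otherwise \<open>{y. k y > 0}\<close> would be an open null set around a point of the support.\<close>

lemma probability_pos_at_support:
  assumes k: "continuous_on UNIV k" "\<And>x. k x \<ge> (0::real)" and x: "x \<in> msupport \<nu>" "k x > 0"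
  shows "Re (\<nu> (\<lambda>y. of_real (k y))) > 0"
proof (rule ccontr)
  assume "\<not> ?thesis"
  then have null: "Re (\<nu> (\<lambda>y. of_real (k y))) = 0"
    using probability_nonneg(1)[OF compact_X prob k] by simp
  have "\<nu> f = 0" if f: "f \<in> cfun" "closure {y. f y \<noteq> 0} \<subseteq> {y. k y > 0}" for f
  proof -
    have "compact (closure {y. f y \<noteq> 0})"
      using compact_X compact_Int_closed[of UNIV] by (metis closed_closure inf_top_left)
    then have "cmod (\<nu> f) \<le> 0"
      using f(2) closure_subset[of "{y. f y \<noteq> 0}"]
      by (intro probability_le_off_null[OF k null _ _ f(1)]) auto
    then show ?thesis by simp
  qed
  then show False
    using x open_positive[OF k(1)] by (auto simp: msupport_def)
qed

end

lemma closed_msupport: "closed (msupport \<nu>)"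
  unfolding msupport_def by (intro closed_Compl open_Union) auto

section \<open>Tensor products of functions\<close>

inductive_set tensor_sums ::
    "('x::topological_space \<times> 'y::topological_space \<Rightarrow> complex) set" where
  ptensor: "f \<in> cfun \<Longrightarrow> g \<in> cfun \<Longrightarrow> ptensor f g \<in> tensor_sums"
| add: "F \<in> tensor_sums \<Longrightarrow> G \<in> tensor_sums \<Longrightarrow> (\<lambda>p. F p + G p) \<in> tensor_sums"

lemma tensor_sums_cfun: "F \<in> tensor_sums \<Longrightarrow> F \<in> cfun"
  by (induction rule: tensor_sums.induct) (auto intro: ptensor_cfun cfun_add)

lemma tensor_sums_mult:
  assumes "F \<in> tensor_sums" "G \<in> tensor_sums"
  shows "(\<lambda>p. F p * G p) \<in> tensor_sums"
  using assms
proof (induction F rule: tensor_sums.induct)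
  case (ptensor f g)
  from ptensor(3) show ?case
  proof (induction G rule: tensor_sums.induct)
    case (ptensor f' g')
    have "(\<lambda>p. ptensor f g p * ptensor f' g' p) = ptensor (\<lambda>x. f x * f' x) (\<lambda>y. g y * g' y)"
      by (auto simp: ptensor_def)
    then show ?case
      using ptensor \<open>f \<in> cfun\<close> \<open>g \<in> cfun\<close> by (simp add: tensor_sums.ptensor cfun_mult)
  qed (simp add: distrib_left tensor_sums.add)
qed (simp add: distrib_right tensor_sums.add)

lemma tensor_sums_const: "(\<lambda>_. c) \<in> tensor_sums"
  using tensor_sums.ptensor[OF cfun_const[of c] cfun_const[of 1]] by (simp add: ptensor_def case_prod_unfold)

lemma compact_UNIV_prod:
  "compact (UNIV :: 'x::topological_space set) \<Longrightarrow> compact (UNIV :: 'y::topological_space set)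
    \<Longrightarrow> compact (UNIV :: ('x \<times> 'y) set)"
  using compact_Times[of "UNIV :: 'x set" "UNIV :: 'y set"] by simp

text \<open>
  The real elements of the algebra are dense among the real continuous functions, by
  Stone--Weierstrass; real and imaginary parts are approximated separately.
\<close>

lemma tensor_sums_dense:
  fixes F :: "'x::t2_space \<times> 'y::t2_space \<Rightarrow> complex"
  assumes X: "compact (UNIV :: 'x set)" and Y: "compact (UNIV :: 'y set)"
    and F: "F \<in> cfun" and "\<epsilon> > 0"
  obtains G where "G \<in> tensor_sums" "\<And>p. cmod (F p - G p) \<le> \<epsilon>"
proof -
  define R where "R = {h :: 'x \<times> 'y \<Rightarrow> real. (\<lambda>p. of_real (h p)) \<in> tensor_sums}"
  interpret function_ring_on R UNIV
  proof
    show "compact (UNIV :: ('x \<times> 'y) set)" by (rule compact_UNIV_prod[OF X Y])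
    show "continuous_on UNIV h" if "h \<in> R" for h
      using that continuous_on_Re[of UNIV "\<lambda>p. complex_of_real (h p)"]
        tensor_sums_cfun[of "\<lambda>p. complex_of_real (h p)"]
      by (simp add: R_def cfun_iff)
    show "(\<lambda>p. f p + g p) \<in> R" if "f \<in> R" "g \<in> R" for f g
      using that tensor_sums.add by (fastforce simp: R_def)
    show "(\<lambda>p. f p * g p) \<in> R" if "f \<in> R" "g \<in> R" for f g
      using that tensor_sums_mult by (fastforce simp: R_def)
    show "(\<lambda>_. c) \<in> R" for c
      by (simp add: R_def tensor_sums_const)
    show "\<exists>h\<in>R. h p \<noteq> h p'" if "p \<noteq> p'" for p p'
    proof (cases "fst p = fst p'")
      case False
      obtain h where h: "continuous_on UNIV h" "h (fst p) = (1::real)" "h (fst p') = 0"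
        using urysohn[OF X closed_singleton closed_singleton, of "fst p" "fst p'"] False
        by (metis Int_emptyI insertI1 singletonD)
      have "(\<lambda>p. of_real (h (fst p))) \<in> tensor_sums"
        using tensor_sums.ptensor[OF cfun_of_real[OF h(1)] cfun_const[of 1]]
        by (simp add: ptensor_def case_prod_unfold)
      then show ?thesis
        using h by (intro bexI[of _ "\<lambda>p. h (fst p)"]) (auto simp: R_def)
    next
      case True
      then have "snd p \<noteq> snd p'" using that by (simp add: prod_eq_iff)
      then obtain h where h: "continuous_on UNIV h" "h (snd p) = (1::real)" "h (snd p') = 0"
        using urysohn[OF Y closed_singleton closed_singleton, of "snd p" "snd p'"]
        by (metis Int_emptyI insertI1 singletonD)
      have "(\<lambda>p. of_real (h (snd p))) \<in> tensor_sums"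
        using tensor_sums.ptensor[OF cfun_const[of 1] cfun_of_real[OF h(1)]]
        by (simp add: ptensor_def case_prod_unfold)
      then show ?thesis
        using h by (intro bexI[of _ "\<lambda>p. h (snd p)"]) (auto simp: R_def)
    qed
  qed
  have "continuous_on UNIV (\<lambda>p. Re (F p))" "continuous_on UNIV (\<lambda>p. Im (F p))"
    using F by (auto simp: cfun_iff intro!: continuous_intros)
  then obtain A B where A: "A \<in> R" "\<And>p. \<bar>Re (F p) - A p\<bar> < \<epsilon> / 2"
    and B: "B \<in> R" "\<And>p. \<bar>Im (F p) - B p\<bar> < \<epsilon> / 2"
    using Stone_Weierstrass_basic[of _ "\<epsilon> / 2"] \<open>\<epsilon> > 0\<close> by (metis UNIV_I half_gt_zero)
  show ?thesis
  proof
    show "(\<lambda>p. of_real (A p) + \<i> * of_real (B p)) \<in> tensor_sums"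
      using A(1) B(1) unfolding R_def
      by (intro tensor_sums.add tensor_sums_mult tensor_sums_const) auto
    fix p
    have "cmod (F p - (of_real (A p) + \<i> * of_real (B p))) \<le> \<bar>Re (F p) - A p\<bar> + \<bar>Im (F p) - B p\<bar>"
      using cmod_le[of "F p - (of_real (A p) + \<i> * of_real (B p))"] by simp
    then show "cmod (F p - (of_real (A p) + \<i> * of_real (B p))) \<le> \<epsilon>"
      using A(2)[of p] B(2)[of p] by linarith
  qed
qed

lemma radon_zero_on_product:
  fixes A :: "('x::t2_space \<times> 'y::t2_space) functional"
  assumes X: "compact (UNIV :: 'x set)" and Y: "compact (UNIV :: 'y set)"
    and A: "A \<in> radon_measures" and zero: "\<And>f g. f \<in> cfun \<Longrightarrow> g \<in> cfun \<Longrightarrow> A (ptensor f g) = 0"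
    and F: "F \<in> cfun"
  shows "A F = 0"
proof (rule radon_eqI[OF compact_UNIV_prod[OF X Y] A F])
  fix \<epsilon> :: real assume "\<epsilon> > 0"
  then obtain G where G: "G \<in> tensor_sums" "\<And>p. cmod (F p - G p) \<le> \<epsilon>"
    using tensor_sums_dense[OF X Y F] by metis
  from G(1) have "A G = 0"
    by (induction rule: tensor_sums.induct)
      (simp_all add: zero radon_add[OF A tensor_sums_cfun tensor_sums_cfun])
  then show "\<exists>G\<in>cfun. A G = 0 \<and> (\<forall>p. cmod (F p - G p) \<le> \<epsilon>)"
    using G tensor_sums_cfun by blast
qed

text \<open>
  The abstract extension is computed by any concrete bounded operator that has the prescribed
  values on elementary tensors.
\<close>

lemma tensor_ext_eq:
  fixes T :: "('x::t2_space \<times> 'y::t2_space \<Rightarrow> complex) \<Rightarrow> ('z::topological_space \<Rightarrow> complex)"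
  assumes X: "compact (UNIV :: 'x set)" and Y: "compact (UNIV :: 'y set)"
    and Z: "compact (UNIV :: 'z set)"
    and T: "bounded_op T" and T_ptensor: "\<And>f g. f \<in> cfun \<Longrightarrow> g \<in> cfun \<Longrightarrow> T (ptensor f g) = \<beta> f g"
    and F: "F \<in> cfun"
  shows "tensor_ext \<beta> F = T F"
proof -
  define T0 where "T0 = restrict T cfun"
  have "tensor_ext \<beta> = T0"
    unfolding tensor_ext_def
  proof (rule the_equality)
    have "bounded_op T0"
      using T cfun_add cfun_mult[OF cfun_const]
      by (auto simp: bounded_op_def linear_op_def T0_def)
    then show "T0 \<in> extensional cfun \<and> bounded_op T0 \<and>
        (\<forall>f\<in>cfun. \<forall>g\<in>cfun. T0 (ptensor f g) = \<beta> f g)"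
      by (simp add: T0_def T_ptensor ptensor_cfun)
  next
    fix S :: "('x \<times> 'y \<Rightarrow> complex) \<Rightarrow> ('z \<Rightarrow> complex)"
    assume S: "S \<in> extensional cfun \<and> bounded_op S \<and>
        (\<forall>f\<in>cfun. \<forall>g\<in>cfun. S (ptensor f g) = \<beta> f g)"
    have radon: "(\<lambda>F. T' F z) \<in> radon_measures" if T': "bounded_op T'"
      for z and T' :: "('x \<times> 'y \<Rightarrow> complex) \<Rightarrow> ('z \<Rightarrow> complex)"
    proof -
      obtain K where "\<And>F. F \<in> cfun \<Longrightarrow> sup_norm (T' F) \<le> K * sup_norm F"
        using T' unfolding bounded_op_def by blast
      then have "cmod (T' F z) \<le> K * sup_norm F" if "F \<in> cfun" for F
        using cmod_le_sup_norm[OF Z, of "T' F" z] that T' order_trans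
        unfolding bounded_op_def linear_op_def by blast
      then show ?thesis
        using T' unfolding bounded_op_def linear_op_def radon_measures_def by auto
    qed
    have "S F = T F" if F: "F \<in> cfun" for F
    proof
      fix z
      have "S F z - T F z = 0"
      proof (rule radon_zero_on_product[OF X Y _ _ F])
        show "(\<lambda>F. S F z - T F z) \<in> radon_measures"
          using S T by (intro radon_diff_measure compact_UNIV_prod X Y radon) auto
      qed (use S in \<open>simp add: T_ptensor\<close>)
      then show "S F z = T F z" by simp
    qed
    then show "S = T0"
      using S by (auto simp: T0_def extensional_def fun_eq_iff)
  qed
  then show ?thesis using F by (simp add: T0_def)
qed

section \<open>Kernels of measures and Fubini's theorem\<close>

text \<open>
  A bounded, weakly continuous family of measures; integrating against it preserves continuity.
  Single measures are constant kernels, so statements on kernels cover them as well.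
\<close>

definition radon_kernel :: "('z::topological_space \<Rightarrow> 'x::topological_space functional) \<Rightarrow> bool"
  where "radon_kernel r \<longleftrightarrow> (\<forall>z. r z \<in> radon_measures) \<and> (\<forall>f\<in>cfun. (\<lambda>z. r z f) \<in> cfun) \<and>
    (\<exists>K. \<forall>z. \<forall>f\<in>cfun. \<forall>c. (\<forall>x. cmod (f x) \<le> c) \<longrightarrow> cmod (r z f) \<le> K * c)"

lemma kernel_radon: "radon_kernel r \<Longrightarrow> r z \<in> radon_measures"
  and kernel_cfun: "radon_kernel r \<Longrightarrow> f \<in> cfun \<Longrightarrow> (\<lambda>z. r z f) \<in> cfun"
  by (auto simp: radon_kernel_def)

lemma kernel_bound:
  assumes "radon_kernel r"
  obtains K where "K \<ge> 0"
    "\<And>z f c. f \<in> cfun \<Longrightarrow> (\<And>x. cmod (f x) \<le> c) \<Longrightarrow> cmod (r z f) \<le> K * c"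
proof -
  obtain K where K: "\<And>z f c. f \<in> cfun \<Longrightarrow> (\<And>x. cmod (f x) \<le> c) \<Longrightarrow> cmod (r z f) \<le> K * c"
    using assms unfolding radon_kernel_def by blast
  have "cmod (r z f) \<le> \<bar>K\<bar> * c" if "f \<in> cfun" "\<And>x. cmod (f x) \<le> c" for z f c
  proof -
    have "c \<ge> 0" using that(2) norm_ge_zero order_trans by blast
    then show ?thesis
      using K[OF that, of z] mult_right_mono[OF abs_ge_self[of K], of c] by linarith
  qed
  then show ?thesis using that[of "\<bar>K\<bar>"] by simp
qed

lemma kernel_const:
  fixes \<nu> :: "'x::topological_space functional"
  assumes "compact (UNIV :: 'x set)" "\<nu> \<in> radon_measures"
  shows "radon_kernel (\<lambda>_. \<nu>)"
proof -
  obtain K where "\<And>f c. f \<in> cfun \<Longrightarrow> (\<And>x. cmod (f x) \<le> c) \<Longrightarrow> cmod (\<nu> f) \<le> K * c"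
    using radon_bound[OF assms] by metis
  then show ?thesis
    using assms(2) unfolding radon_kernel_def by (blast intro: cfun_const)
qed

lemma kernel_probability:
  fixes r :: "'z::topological_space \<Rightarrow> 'x::topological_space functional"
  assumes "compact (UNIV :: 'x set)" "\<And>z. probability_measure (r z)"
    and "\<And>f. f \<in> cfun \<Longrightarrow> (\<lambda>z. r z f) \<in> cfun"
  shows "radon_kernel r"
  unfolding radon_kernel_def
proof (intro conjI exI[of _ 1] allI ballI impI)
  show "r z \<in> radon_measures" for z by (rule probability_radon[OF assms(2)])
  show "(\<lambda>z. r z f) \<in> cfun" if "f \<in> cfun" for f by (rule assms(3)[OF that])
  show "cmod (r z f) \<le> 1 * c" if "f \<in> cfun" "\<forall>x. cmod (f x) \<le> c" for z f c
    using probability_bound[OF assms(1,2)] that by simp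
qed

lemma kernel_reindex:
  assumes "radon_kernel r" "continuous_on UNIV h"
  shows "radon_kernel (\<lambda>z. r (h z))"
  using assms(1) cfun_compose[OF _ assms(2)] unfolding radon_kernel_def by fast

lemma dirac_probability:
  assumes "compact (UNIV :: 'x::topological_space set)"
  shows "probability_measure (dirac (x :: 'x))"
proof -
  have "dirac x \<in> radon_measures"
    by (rule radonI[OF assms, where K = 1]) (simp_all add: dirac_def)
  then show ?thesis
    by (auto simp: probability_measure_def dirac_def)
qed

lemma kernel_dirac:
  assumes "compact (UNIV :: 'x::topological_space set)"
  shows "radon_kernel (dirac :: 'x \<Rightarrow> 'x functional)"
  by (rule kernel_probability[OF assms dirac_probability[OF assms]]) (simp add: dirac_def)


text \<open>
  Joint continuity: moving \<open>v\<close> changes the integrand uniformly little, and moving \<open>z\<close> is covered by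
  weak continuity of the kernel at a fixed integrand.
\<close>

lemma kernel_slice_left:
  fixes r :: "'z::topological_space \<Rightarrow> 'x::topological_space functional"
    and F :: "'x \<times> 'v::topological_space \<Rightarrow> complex"
  assumes X: "compact (UNIV :: 'x set)" and r: "radon_kernel r" and F: "F \<in> cfun"
  shows "(\<lambda>(z, v). r z (\<lambda>u. F (u, v))) \<in> cfun"
proof (rule cfun_neighbourhoodI)
  fix p :: "'z \<times> 'v" and \<epsilon> :: real assume "\<epsilon> > 0"
  obtain z v where p: "p = (z, v)" by fastforce
  obtain K where K: "K \<ge> 0"
    "\<And>z f c. f \<in> cfun \<Longrightarrow> (\<And>x. cmod (f x) \<le> c) \<Longrightarrow> cmod (r z f) \<le> K * c"
    using kernel_bound[OF r] by metis
  define \<delta> where "\<delta> = \<epsilon> / (2 * (K + 1))"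
  have "\<delta> > 0" "K * \<delta> < \<epsilon> / 2"
    using \<open>\<epsilon> > 0\<close> K(1) by (auto simp: \<delta>_def field_simps)
  obtain V where V: "open V" "v \<in> V" "\<And>v' u. v' \<in> V \<Longrightarrow> cmod (F (u, v') - F (u, v)) \<le> \<delta>"
    using uniform_slice[OF X F \<open>\<delta> > 0\<close>, of v] by blast
  obtain U where U: "open U" "z \<in> U"
    "\<And>z'. z' \<in> U \<Longrightarrow> cmod (r z' (\<lambda>u. F (u, v)) - r z (\<lambda>u. F (u, v))) < \<epsilon> / 2"
    using cfun_neighbourhood[OF kernel_cfun[OF r cfun_slice_left[OF F]], of "\<epsilon> / 2" z v] \<open>\<epsilon> > 0\<close>
    by (metis half_gt_zero)
  have "cmod (r z' (\<lambda>u. F (u, v')) - r z (\<lambda>u. F (u, v))) < \<epsilon>" if "z' \<in> U" "v' \<in> V" for z' v'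
  proof -
    have "cmod (r z' (\<lambda>u. F (u, v')) - r z' (\<lambda>u. F (u, v))) = cmod (r z' (\<lambda>u. F (u, v') - F (u, v)))"
      by (simp add: radon_diff[OF kernel_radon[OF r] cfun_slice_left[OF F] cfun_slice_left[OF F]])
    also have "\<dots> \<le> K * \<delta>"
      using V(3)[OF that(2)] by (intro K(2) cfun_diff cfun_slice_left[OF F])
    finally have "cmod (r z' (\<lambda>u. F (u, v')) - r z' (\<lambda>u. F (u, v))) < \<epsilon> / 2"
      using \<open>K * \<delta> < \<epsilon> / 2\<close> by linarith
    from norm_triangle_lt[OF add_strict_mono[OF this U(3)[OF that(1)], simplified]]
    show ?thesis by simp
  qed
  then show "\<exists>W. open W \<and> p \<in> W \<and>
      (\<forall>w\<in>W. cmod ((case w of (z, v) \<Rightarrow> r z (\<lambda>u. F (u, v)))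
        - (case p of (z, v) \<Rightarrow> r z (\<lambda>u. F (u, v)))) < \<epsilon>)"
    using U(1,2) V(1,2) by (intro exI[of _ "U \<times> V"]) (auto simp: p intro: open_Times)
qed

lemma kernel_slice_right:
  fixes s :: "'z::topological_space \<Rightarrow> 'y::topological_space functional"
  assumes "compact (UNIV :: 'y set)" "radon_kernel s" "F \<in> cfun"
  shows "(\<lambda>(x, z). s z (\<lambda>v. F (x, v))) \<in> cfun"
  using cfun_swap[OF kernel_slice_left[OF assms(1,2) cfun_swap[OF assms(3)]]]
  by (simp add: case_prod_unfold)

definition product_measure :: "'x functional \<Rightarrow> 'y functional \<Rightarrow> ('x \<times> 'y) functional"
  where "product_measure \<nu> m = (\<lambda>F. \<nu> (\<lambda>x. m (\<lambda>y. F (x, y))))"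

lemma measure_slice_right:
  fixes m :: "'y::topological_space functional"
  assumes "compact (UNIV :: 'y set)" "m \<in> radon_measures" "F \<in> cfun"
  shows "(\<lambda>x. m (\<lambda>y. F (x, y))) \<in> cfun"
  using cfun_slice_left[OF kernel_slice_right[OF assms(1) kernel_const[OF assms(1,2)] assms(3)],
      of undefined] by simp

lemma measure_slice_left:
  fixes \<nu> :: "'x::topological_space functional"
  assumes "compact (UNIV :: 'x set)" "\<nu> \<in> radon_measures" "F \<in> cfun"
  shows "(\<lambda>y. \<nu> (\<lambda>x. F (x, y))) \<in> cfun"
  using cfun_slice_right[OF kernel_slice_left[OF assms(1) kernel_const[OF assms(1,2)] assms(3)],
      of undefined] by simp

lemma kernel_product:
  fixes r :: "'z::topological_space \<Rightarrow> 'x::topological_space functional"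
    and s :: "'w::topological_space \<Rightarrow> 'y::topological_space functional"
  assumes X: "compact (UNIV :: 'x set)" and Y: "compact (UNIV :: 'y set)"
    and r: "radon_kernel r" and s: "radon_kernel s"
  shows "radon_kernel (\<lambda>(z, w). product_measure (r z) (s w))"
proof -
  obtain K where K: "K \<ge> 0"
    "\<And>z f c. f \<in> cfun \<Longrightarrow> (\<And>x. cmod (f x) \<le> c) \<Longrightarrow> cmod (r z f) \<le> K * c"
    using kernel_bound[OF r] by metis
  obtain L where L: "L \<ge> 0"
    "\<And>w f c. f \<in> cfun \<Longrightarrow> (\<And>x. cmod (f x) \<le> c) \<Longrightarrow> cmod (s w f) \<le> L * c"
    using kernel_bound[OF s] by metis
  have bound: "cmod (product_measure (r z) (s w) F) \<le> (K * L) * c"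
    if "F \<in> cfun" "\<And>p. cmod (F p) \<le> c" for z w F c
    unfolding product_measure_def mult.assoc
    by (rule K(2)[OF measure_slice_right[OF Y kernel_radon[OF s] that(1)]
          L(2)[OF cfun_slice_right[OF that(1)] that(2)]])
  have radon: "product_measure (r z) (s w) \<in> radon_measures" for z w
  proof (rule radonI[OF compact_UNIV_prod[OF X Y], where K = "K * L"])
    fix F G :: "'x \<times> 'y \<Rightarrow> complex" and c
    assume F: "F \<in> cfun" and G: "G \<in> cfun"
    show "product_measure (r z) (s w) (\<lambda>p. F p + G p)
        = product_measure (r z) (s w) F + product_measure (r z) (s w) G"
      unfolding product_measure_def
      by (subst radon_add[OF kernel_radon[OF s] cfun_slice_right[OF F] cfun_slice_right[OF G]])
        (rule radon_add[OF kernel_radon[OF r] measure_slice_right[OF Y kernel_radon[OF s] F]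
            measure_slice_right[OF Y kernel_radon[OF s] G]])
  next
    fix F :: "'x \<times> 'y \<Rightarrow> complex" and c
    assume F: "F \<in> cfun"
    show "product_measure (r z) (s w) (\<lambda>p. c * F p) = c * product_measure (r z) (s w) F"
      unfolding product_measure_def
      by (subst radon_scale[OF kernel_radon[OF s] cfun_slice_right[OF F]])
        (rule radon_scale[OF kernel_radon[OF r] measure_slice_right[OF Y kernel_radon[OF s] F]])
  qed (rule bound)
  have "(\<lambda>(z, w). product_measure (r z) (s w) F) \<in> cfun" if "F \<in> cfun" for F
    using kernel_slice_left[OF X r kernel_slice_right[OF Y s that]]
    by (simp add: product_measure_def)
  then show ?thesis
    unfolding radon_kernel_def
    by (intro conjI exI[of _ "K * L"]) (auto simp: case_prod_unfold intro: radon bound)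
qed

lemma product_measure_radon:
  fixes \<nu> :: "'x::topological_space functional" and m :: "'y::topological_space functional"
  assumes X: "compact (UNIV :: 'x set)" and Y: "compact (UNIV :: 'y set)"
    and "\<nu> \<in> radon_measures" "m \<in> radon_measures"
  shows "product_measure \<nu> m \<in> radon_measures"
  using kernel_radon[OF kernel_product[OF X Y kernel_const[OF X assms(3)] kernel_const[OF Y assms(4)]],
      of undefined]
  by (simp add: case_prod_unfold)

lemma kernel_bind:
  fixes r :: "'z::topological_space \<Rightarrow> 'x::topological_space functional"
  assumes Z: "compact (UNIV :: 'z set)" and X: "compact (UNIV :: 'x set)"
    and \<nu>: "\<nu> \<in> radon_measures" and r: "radon_kernel r"
  shows "(\<lambda>f. \<nu> (\<lambda>z. r z f)) \<in> radon_measures"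
proof -
  obtain K where K: "\<And>z f c. f \<in> cfun \<Longrightarrow> (\<And>x. cmod (f x) \<le> c) \<Longrightarrow> cmod (r z f) \<le> K * c"
    using kernel_bound[OF r] by metis
  obtain L where L: "\<And>f c. f \<in> cfun \<Longrightarrow> (\<And>x. cmod (f x) \<le> c) \<Longrightarrow> cmod (\<nu> f) \<le> L * c"
    using radon_bound[OF Z \<nu>] by metis
  show ?thesis
  proof (rule radonI[OF X, where K = "L * K"])
    show "cmod (\<nu> (\<lambda>z. r z f)) \<le> L * K * c" if "f \<in> cfun" "\<And>x. cmod (f x) \<le> c" for f c
      unfolding mult.assoc by (rule L[OF kernel_cfun[OF r that(1)] K[OF that]])
  qed (simp_all add: radon_add[OF kernel_radon[OF r]] radon_scale[OF kernel_radon[OF r]]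
      radon_add[OF \<nu>] radon_scale[OF \<nu>] kernel_cfun[OF r])
qed

text \<open>Both iterated integrals are measures on the product which agree on elementary tensors.\<close>

theorem fubini:
  fixes \<nu> :: "'x::t2_space functional" and m :: "'y::t2_space functional"
  assumes X: "compact (UNIV :: 'x set)" and Y: "compact (UNIV :: 'y set)"
    and \<nu>: "\<nu> \<in> radon_measures" and m: "m \<in> radon_measures" and F: "F \<in> cfun"
  shows "\<nu> (\<lambda>x. m (\<lambda>y. F (x, y))) = m (\<lambda>y. \<nu> (\<lambda>x. F (x, y)))"
proof -
  define A where "A = (\<lambda>F. product_measure \<nu> m F - product_measure m \<nu> (\<lambda>p. F (snd p, fst p)))"
  have "radon_kernel (\<lambda>p :: 'y \<times> 'x. dirac (snd p, fst p))"
    by (intro kernel_reindex[OF kernel_dirac] compact_UNIV_prod X Y continuous_intros)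
  from kernel_bind[OF compact_UNIV_prod[OF Y X] compact_UNIV_prod[OF X Y] _ this]
  have "(\<lambda>F. product_measure m \<nu> (\<lambda>p. F (snd p, fst p))) \<in> radon_measures"
    using product_measure_radon[OF Y X m \<nu>] by (auto simp: dirac_def)
  then have "A \<in> radon_measures"
    unfolding A_def by (intro radon_diff_measure compact_UNIV_prod product_measure_radon X Y \<nu> m)
  moreover have "A (ptensor f g) = 0" if "f \<in> cfun" "g \<in> cfun" for f g
    by (simp add: A_def product_measure_def ptensor_def radon_scale[OF m that(2)]
        radon_scale_right[OF \<nu> that(1)] radon_scale[OF m that(2)] radon_scale_right[OF m that(2)] radon_scale[OF \<nu> that(1)])
  ultimately have "A F = 0"
    using radon_zero_on_product[OF X Y _ _ F] by blast
  then show ?thesis by (simp add: A_def product_measure_def)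
qed

lemma kernel_bounded_op:
  fixes r :: "'z::topological_space \<Rightarrow> 'x::topological_space functional"
  assumes X: "compact (UNIV :: 'x set)" and r: "radon_kernel r"
  shows "bounded_op (\<lambda>f z. r z f)"
proof -
  obtain K where "\<And>z f c. f \<in> cfun \<Longrightarrow> (\<And>x. cmod (f x) \<le> c) \<Longrightarrow> cmod (r z f) \<le> K * c"
    using kernel_bound[OF r] by metis
  then have "\<exists>K. \<forall>f\<in>cfun. sup_norm (\<lambda>z. r z f) \<le> K * sup_norm f"
    using cmod_le_sup_norm[OF X] by (meson sup_norm_le)
  then show ?thesis
    by (simp add: bounded_op_def linear_op_def kernel_cfun[OF r] radon_add[OF kernel_radon[OF r]]
        radon_scale[OF kernel_radon[OF r]])
qed

lemma op_tensor_op_kernel: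
  fixes r :: "'x::t2_space \<Rightarrow> 'x functional" and s :: "'y::t2_space \<Rightarrow> 'y functional"
  assumes X: "compact (UNIV :: 'x set)" and Y: "compact (UNIV :: 'y set)"
    and r: "radon_kernel r" and s: "radon_kernel s" and F: "F \<in> cfun"
  shows "op_tensor_op (\<lambda>f x. r x f) (\<lambda>f y. s y f) F
    = (\<lambda>(x, y). r x (\<lambda>u. s y (\<lambda>v. F (u, v))))"
proof -
  have "op_tensor_op (\<lambda>f x. r x f) (\<lambda>f y. s y f) F
      = (\<lambda>z. (case z of (x, y) \<Rightarrow> product_measure (r x) (s y)) F)"
    unfolding op_tensor_op_def
  proof (rule tensor_ext_eq[OF X Y compact_UNIV_prod[OF X Y]
        kernel_bounded_op[OF compact_UNIV_prod[OF X Y] kernel_product[OF X Y r s]] _ F])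
    fix f :: "'x \<Rightarrow> complex" and g :: "'y \<Rightarrow> complex"
    assume "f \<in> cfun" "g \<in> cfun"
    then show "(\<lambda>z. (case z of (x, y) \<Rightarrow> product_measure (r x) (s y)) (ptensor f g))
        = ptensor (\<lambda>x. r x f) (\<lambda>y. s y g)"
      by (simp add: fun_eq_iff product_measure_def ptensor_def radon_scale[OF kernel_radon[OF s]]
          radon_scale_right[OF kernel_radon[OF r]])
  qed
  then show ?thesis by (simp add: product_measure_def case_prod_unfold)
qed

lemma fun_tensor_id_dirac:
  fixes F :: "'x::t2_space \<times> 'y::t2_space \<Rightarrow> complex"
  assumes X: "compact (UNIV :: 'x set)" and Y: "compact (UNIV :: 'y set)" and F: "F \<in> cfun"
  shows "fun_tensor_id (dirac e) F = (\<lambda>y. F (e, y))"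
  unfolding fun_tensor_id_def
proof (rule tensor_ext_eq[OF X Y Y _ _ F])
  show "bounded_op (\<lambda>F (y :: 'y). F (e, y))"
    using kernel_bounded_op[OF compact_UNIV_prod[OF X Y]
        kernel_reindex[OF kernel_dirac[OF compact_UNIV_prod[OF X Y]], of "Pair e"]]
    by (simp add: dirac_def continuous_on_Pair)
qed (simp add: ptensor_def dirac_def)

lemma id_tensor_fun_dirac:
  fixes F :: "'x::t2_space \<times> 'y::t2_space \<Rightarrow> complex"
  assumes X: "compact (UNIV :: 'x set)" and Y: "compact (UNIV :: 'y set)" and F: "F \<in> cfun"
  shows "id_tensor_fun (dirac e) F = (\<lambda>x. F (x, e))"
  unfolding id_tensor_fun_def
proof (rule tensor_ext_eq[OF X Y X _ _ F])
  show "bounded_op (\<lambda>F (x :: 'x). F (x, e))"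
    using kernel_bounded_op[OF compact_UNIV_prod[OF X Y]
        kernel_reindex[OF kernel_dirac[OF compact_UNIV_prod[OF X Y]], of "\<lambda>x. (x, e)"]]
    by (simp add: dirac_def continuous_on_Pair)
qed (simp add: ptensor_def dirac_def)

section \<open>Convolution\<close>

context compact_DJS_hypergroup
begin

lemma compact_square: "compact (UNIV :: ('q \<times> 'q) set)"
  by (rule compact_UNIV_prod[OF compact_space compact_space])

lemma pc_kernel: "radon_kernel (\<lambda>p. pc (fst p) (snd p))"
  using pc_continuous
  by (intro kernel_probability[OF compact_space] pc_prob) (simp add: comult_def case_prod_unfold)

lemma pc_kernel_of:
  "continuous_on UNIV g \<Longrightarrow> continuous_on UNIV h \<Longrightarrow> radon_kernel (\<lambda>z. pc (g z) (h z))"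
  using kernel_reindex[OF pc_kernel, of "\<lambda>z. (g z, h z)"] by (simp add: continuous_on_Pair)

lemma pc_cfun:
  "f \<in> cfun \<Longrightarrow> continuous_on UNIV g \<Longrightarrow> continuous_on UNIV h \<Longrightarrow> (\<lambda>z. pc (g z) (h z) f) \<in> cfun"
  using kernel_cfun[OF pc_kernel_of] .

lemma pc_cfun_left: "f \<in> cfun \<Longrightarrow> (\<lambda>x. pc x y f) \<in> cfun"
  and pc_cfun_right: "f \<in> cfun \<Longrightarrow> (\<lambda>y. pc x y f) \<in> cfun"
  by (erule pc_cfun; intro continuous_intros)+

lemma continuous_on_dag: "continuous_on UNIV g \<Longrightarrow> continuous_on UNIV (\<lambda>x. dag (g x))"
  using continuous_on_compose2[OF dag_continuous] by auto

lemma cfun_dag: "f \<in> cfun \<Longrightarrow> (\<lambda>x. f (dag x)) \<in> cfun"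
  by (rule cfun_compose[OF _ dag_continuous])

lemma pc_radon: "pc x y \<in> radon_measures"
  by (rule probability_radon[OF pc_prob])

lemma pc_dag: "f \<in> cfun \<Longrightarrow> pc x y (\<lambda>z. f (dag z)) = pc (dag y) (dag x) f"
  using dag_pc[of f x y] by (simp add: pushforward_def comp_def)

lemma conv_radon:
  assumes "\<nu> \<in> radon_measures" "m \<in> radon_measures"
  shows "conv pc \<nu> m \<in> radon_measures"
  using kernel_bind[OF compact_square compact_space
      product_measure_radon[OF compact_space compact_space assms] pc_kernel]
  by (simp add: conv_def product_measure_def comult_def)

lemma conv_dirac_left: "conv pc (dirac x) m f = m (\<lambda>y. pc x y f)"
  and conv_dirac_right: "conv pc \<nu> (dirac y) f = \<nu> (\<lambda>x. pc x y f)"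
  by (simp_all add: conv_def dirac_def comult_def)

lemma dirac_radon: "dirac x \<in> (radon_measures :: 'q functional set)"
  by (rule probability_radon[OF dirac_probability[OF compact_space]])

lemma pc_assoc: "f \<in> cfun \<Longrightarrow> pc x y (\<lambda>s. pc s z f) = pc y z (\<lambda>t. pc x t f)"
  using conv_assoc[OF dirac_radon dirac_radon dirac_radon, of f x y z]
  by (simp add: conv_def dirac_def comult_def)

lemma conv_diff_right:
  assumes "\<nu> \<in> radon_measures" "m \<in> radon_measures" "m' \<in> radon_measures" "f \<in> cfun"
  shows "conv pc \<nu> (\<lambda>f. m f - m' f) f = conv pc \<nu> m f - conv pc \<nu> m' f"
proof -
  have F: "(\<lambda>p. pc (fst p) (snd p) f) \<in> cfun"
    by (intro kernel_cfun[OF pc_kernel] assms)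
  have "(\<lambda>x. m (\<lambda>y. pc x y f)) \<in> cfun" "(\<lambda>x. m' (\<lambda>y. pc x y f)) \<in> cfun"
    using measure_slice_right[OF compact_space _ F] assms(2,3) by simp_all
  then show ?thesis
    unfolding conv_def comult_def by (simp add: radon_diff[OF assms(1)])
qed

lemma dag_kernel: "radon_kernel (\<lambda>x. dirac (dag x))"
  by (rule kernel_reindex[OF kernel_dirac[OF compact_space] dag_continuous])

lemma pushforward_dag_radon:
  "\<nu> \<in> radon_measures \<Longrightarrow> pushforward dag \<nu> \<in> radon_measures"
  using kernel_bind[OF compact_space compact_space _ dag_kernel]
  by (simp add: dirac_def pushforward_def comp_def)

lemma conv_dag:
  assumes \<nu>: "\<nu> \<in> radon_measures" and m: "m \<in> radon_measures" and f: "f \<in> cfun"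
  shows "conv pc \<nu> m (\<lambda>x. f (dag x)) = conv pc (pushforward dag m) (pushforward dag \<nu>) f"
proof -
  have "(\<lambda>p. pc (dag (snd p)) (dag (fst p)) f) \<in> cfun"
    by (intro pc_cfun f continuous_on_dag continuous_intros)
  from fubini[OF compact_space compact_space \<nu> m this] show ?thesis
    by (simp add: conv_def comult_def pushforward_def comp_def pc_dag[OF f])
qed

text \<open>
  The support of \<open>dag x * z\<close> depends continuously on \<open>x\<close> and \<open>z\<close>, and it contains \<open>e\<close> only if
  \<open>x = z\<close>. As the pairs with \<open>\<epsilon> \<le> \<bar>f x - f z\<bar>\<close> form a compact set off the diagonal, one
  neighbourhood of \<open>e\<close> avoids the supports for all of them.
\<close>

lemma convolution_vanishes_off_diagonal:
  assumes f: "f \<in> cfun" and "\<epsilon> > 0"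
  obtains W where "open W" "e \<in> W" "\<And>k x z. k \<in> cfun \<Longrightarrow> (\<And>y. y \<notin> W \<Longrightarrow> k y = 0) \<Longrightarrow>
    \<epsilon> \<le> cmod (f x - f z) \<Longrightarrow> pc (dag x) z k = 0"
proof -
  define D where "D = {p. \<epsilon> \<le> cmod (f (fst p) - f (snd p))}"
  have "(\<lambda>p. f (fst p)) \<in> cfun" "(\<lambda>p. f (snd p)) \<in> cfun"
    by (intro cfun_compose[OF f] continuous_intros)+
  then have "closed D"
    unfolding D_def cfun_iff by (intro closed_Collect_le continuous_intros)
  then have D: "compact D"
    using compact_Int_closed[OF compact_square] by simp
  define S where "S p = msupport (pc (dag (fst p)) (snd p))" for p
  have "\<exists>V W. open V \<and> open W \<and> S p \<subseteq> V \<and> e \<in> W \<and> V \<inter> W = {}" if "p \<in> D" for p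
  proof -
    have "fst p \<noteq> snd p" using that \<open>\<epsilon> > 0\<close> by (auto simp: D_def)
    then have "e \<notin> S p"
      unfolding S_def neutral_in_support using dag_dag by metis
    then have "{e} \<inter> S p = {}" by simp
    with urysohn[OF compact_space closed_singleton[of e], of "S p"]
    obtain h where h: "continuous_on UNIV h" "h e = (1::real)" "\<And>y. y \<in> S p \<Longrightarrow> h y = 0"
      unfolding S_def using closed_msupport by (metis singletonI)
    have "open {y. h y < 1/2}" "open {y. h y > 1/2}"
      using h(1) by (auto intro!: open_Collect_less continuous_intros)
    with h show ?thesis
      by (intro exI[of _ "{y. h y < 1/2}"] exI[of _ "{y. h y > 1/2}"]) auto
  qed
  then obtain V W where VW: "\<And>p. p \<in> D \<Longrightarrow> open (V p)" "\<And>p. p \<in> D \<Longrightarrow> open (W p)"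
    "\<And>p. p \<in> D \<Longrightarrow> S p \<subseteq> V p" "\<And>p. p \<in> D \<Longrightarrow> e \<in> W p" "\<And>p. p \<in> D \<Longrightarrow> V p \<inter> W p = {}"
    by metis
  have compact_support: "compact (msupport (pc x y))" for x y
    using compact_Int_closed[OF compact_space closed_msupport] by simp
  have nonempty_support: "msupport (pc x y) \<noteq> {}" for x y
  proof
    assume "msupport (pc x y) = {}"
    then have "pc x y (\<lambda>_. 1) = 0"
      by (intro probability_zero_on_support[OF compact_space pc_prob] cfun_const) auto
    then show False by (simp add: probability_const[OF pc_prob])
  qed
  have S_open: "open {p. S p \<subseteq> U}" if "open U" for U
  proof -
    have "openin michael_topology {A. compact A \<and> A \<noteq> {} \<and> A \<inter> UNIV \<noteq> {} \<and> A \<subseteq> U}"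
      unfolding michael_topology_def using that by (intro topology_generated_by_Basis) blast
    from openin_continuous_map_preimage[OF support_continuous this]
    moreover have "S (dag x, y) = msupport (pc x y)" for x y
      by (simp add: S_def dag_dag)
    ultimately have "open {p. S (dag (fst p), snd p) \<subseteq> U}"
      using compact_support nonempty_support by (simp add: case_prod_unfold)
    from open_vimage[OF this, of "\<lambda>p. (dag (fst p), snd p)"]
    show ?thesis
      by (simp add: vimage_def dag_dag continuous_on_Pair continuous_on_dag continuous_on_fst
          continuous_on_snd)
  qed
  have "D \<subseteq> (\<Union>p\<in>D. {p'. S p' \<subseteq> V p})" using VW(3) by blast
  from compactE_image[OF D S_open[OF VW(1)] this]
  obtain T where T: "T \<subseteq> D" "finite T" "D \<subseteq> (\<Union>p\<in>T. {p'. S p' \<subseteq> V p})" .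
  show ?thesis
  proof
    show "open (\<Inter>p\<in>T. W p)" using T(1,2) VW(2) by (intro open_INT) auto
    show "e \<in> (\<Inter>p\<in>T. W p)" using T(1) VW(4) by auto
    fix k x z
    assume k: "k \<in> cfun" "\<And>y. y \<notin> (\<Inter>p\<in>T. W p) \<Longrightarrow> k y = 0" and "\<epsilon> \<le> cmod (f x - f z)"
    then have "(x, z) \<in> D" by (simp add: D_def)
    then obtain p where p: "p \<in> T" "S (x, z) \<subseteq> V p" using T(3) by blast
    then have "S (x, z) \<inter> (\<Inter>p\<in>T. W p) = {}" using T(1) VW(5)[of p] by blast
    then show "pc (dag x) z k = 0"
      by (intro probability_zero_on_support[OF compact_space pc_prob k(1)] k(2)) (auto simp: S_def)
  qed
qed

end

section \<open>Haar measure and approximate identities\<close>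

locale compact_hypergroup_with_haar = compact_DJS_hypergroup pc dag e
  for pc :: "'q::t2_space \<Rightarrow> 'q \<Rightarrow> 'q functional" and dag e +
  fixes \<mu> :: "'q functional"
  assumes haar: "haar_measure pc \<mu>"
begin

lemma \<mu>_prob: "probability_measure \<mu>"
  using haar by (simp add: haar_measure_def)

lemma \<mu>_radon: "\<mu> \<in> radon_measures"
  by (rule probability_radon[OF \<mu>_prob])

lemma \<mu>_left: "f \<in> cfun \<Longrightarrow> \<mu> (\<lambda>y. pc x y f) = \<mu> f"
  using haar by (simp add: haar_measure_def conv_dirac_left)

text \<open>
  Integrate \<open>f (dag x * y) = f (dag (dag y * x))\<close> in both orders: the integral over \<open>y\<close> is \<open>\<mu> f\<close>
  and the one over \<open>x\<close> is that of \<open>f\<close> composed with \<open>dag\<close>, both by left invariance.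
\<close>

lemma \<mu>_dag: "f \<in> cfun \<Longrightarrow> \<mu> (\<lambda>x. f (dag x)) = \<mu> f"
proof -
  assume f: "f \<in> cfun"
  have "(\<lambda>p. pc (dag (fst p)) (snd p) f) \<in> cfun"
    by (intro pc_cfun f continuous_on_dag continuous_intros)
  from fubini[OF compact_space compact_space \<mu>_radon \<mu>_radon this]
  have "\<mu> f = \<mu> (\<lambda>y. \<mu> (\<lambda>x. pc (dag x) y f))"
    by (simp add: \<mu>_left[OF f] probability_const[OF \<mu>_prob])
  also have "pc (dag x) y f = pc (dag y) x (\<lambda>z. f (dag z))" for x y
    by (simp add: pc_dag[OF f] dag_dag)
  then have "\<mu> (\<lambda>y. \<mu> (\<lambda>x. pc (dag x) y f)) = \<mu> (\<lambda>z. f (dag z))"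
    by (simp add: \<mu>_left[OF cfun_dag[OF f]] probability_const[OF \<mu>_prob])
  finally show ?thesis by simp
qed

lemma \<mu>_right: "f \<in> cfun \<Longrightarrow> \<mu> (\<lambda>x. pc x y f) = \<mu> f"
proof -
  assume f: "f \<in> cfun"
  have "\<mu> (\<lambda>x. pc x y f) = \<mu> (\<lambda>x. pc (dag x) y f)"
    by (simp add: \<mu>_dag[OF pc_cfun_left[OF f]])
  also have "\<dots> = \<mu> (\<lambda>x. pc (dag y) x (\<lambda>z. f (dag z)))"
    by (simp add: pc_dag[OF f] dag_dag)
  finally show ?thesis
    by (simp add: \<mu>_left f cfun_dag \<mu>_dag)
qed

lemma pc_of_real:
  assumes "continuous_on UNIV k" "\<And>x. k x \<ge> (0::real)"
  shows "of_real (Re (pc x y (\<lambda>z. of_real (k z)))) = pc x y (\<lambda>z. of_real (k z))"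
    and "Re (pc x y (\<lambda>z. of_real (k z))) \<ge> 0"
  using probability_nonneg[OF compact_space pc_prob assms] by (auto simp: complex_eq_iff)

text \<open>
  If \<open>k\<close> were null, so would be its translates, finitely many of which have a sum without zeros.
\<close>

lemma \<mu>_positive_at_neutral:
  assumes k: "continuous_on UNIV k" "\<And>x. k x \<ge> (0::real)" "k e > 0"
  shows "Re (\<mu> (\<lambda>x. of_real (k x))) > 0"
proof (rule ccontr)
  assume "\<not> ?thesis"
  then have null: "\<mu> (\<lambda>x. of_real (k x)) = 0"
    using probability_nonneg[OF compact_space \<mu>_prob k(1,2)] by (simp add: complex_eq_iff)
  define h where "h z x = Re (pc (dag z) x (\<lambda>y. of_real (k y)))" for z x
  have h_eq: "complex_of_real (h z x) = pc (dag z) x (\<lambda>y. of_real (k y))" for z x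
    unfolding h_def by (rule pc_of_real(1)[OF k(1,2)])
  have h: "continuous_on UNIV (h z)" for z
    unfolding h_def using pc_cfun_right[OF cfun_of_real[OF k(1)]]
    by (auto simp: cfun_iff intro!: continuous_on_Re)
  have h_nonneg: "h z x \<ge> 0" for z x
    unfolding h_def by (rule pc_of_real(2)[OF k(1,2)])
  have "h z z > 0" for z
    unfolding h_def
    by (rule probability_pos_at_support[OF compact_space pc_prob k(1,2) _ k(3)])
      (simp add: neutral_in_support)
  then have "UNIV \<subseteq> (\<Union>z\<in>UNIV. {x. h z x > 0})" by blast
  from compactE_image[OF compact_space open_positive[OF h] this]
  obtain T where T: "finite T" "UNIV \<subseteq> (\<Union>z\<in>T. {x. h z x > 0})" .
  define s where "s x = (\<Sum>z\<in>T. h z x)" for x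
  have s: "continuous_on UNIV s"
    unfolding s_def by (intro continuous_intros h)
  have s_pos: "s x > 0" for x
  proof -
    obtain z where "z \<in> T" "h z x > 0" using T(2) by blast
    then show ?thesis
      unfolding s_def using T(1) h_nonneg by (intro sum_pos2[of T z]) auto
  qed
  have "\<mu> (\<lambda>x. of_real (s x)) = (\<Sum>z\<in>T. \<mu> (\<lambda>x. of_real (h z x)))"
    unfolding s_def of_real_sum by (intro radon_sum \<mu>_radon T cfun_of_real h)
  also have "\<dots> = 0"
    unfolding h_eq by (simp add: \<mu>_left[OF cfun_of_real[OF k(1)]] null)
  finally have "cmod (\<mu> (\<lambda>_. 1)) \<le> 0"
    by (intro probability_le_off_null[OF compact_space \<mu>_prob s _ _ compact_space])
      (auto simp: s_pos less_imp_le cfun_const)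
  then show False by (simp add: probability_const[OF \<mu>_prob])
qed

text \<open>The translate of \<open>k\<close> by \<open>x\<close> has the same integral and is positive at \<open>e\<close>.\<close>

lemma \<mu>_positive:
  assumes k: "continuous_on UNIV k" "\<And>x. k x \<ge> (0::real)" "k x > 0"
  shows "Re (\<mu> (\<lambda>x. of_real (k x))) > 0"
proof -
  have kc: "(\<lambda>y. complex_of_real (k y)) \<in> cfun" by (rule cfun_of_real[OF k(1)])
  define h where "h y = Re (pc x y (\<lambda>z. of_real (k z)))" for y
  have h_eq: "complex_of_real (h y) = pc x y (\<lambda>z. of_real (k z))" for y
    unfolding h_def by (rule pc_of_real(1)[OF k(1,2)])
  have "Re (\<mu> (\<lambda>y. of_real (h y))) > 0"
  proof (rule \<mu>_positive_at_neutral)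
    show "continuous_on UNIV h"
      unfolding h_def using pc_cfun_right[OF kc] by (auto simp: cfun_iff intro!: continuous_on_Re)
    show "h y \<ge> 0" for y unfolding h_def by (rule pc_of_real(2)[OF k(1,2)])
    show "h e > 0" using k(3) by (simp add: h_def neutral_right[OF kc] dirac_def)
  qed
  then show ?thesis by (simp add: h_eq \<mu>_left[OF kc])
qed

text \<open>Test against the complex conjugate of \<open>g\<close>.\<close>

lemma \<mu>_definite:
  assumes g: "g \<in> cfun" and orth: "\<And>f. f \<in> cfun \<Longrightarrow> \<mu> (\<lambda>x. g x * f x) = 0"
  shows "g x = 0"
proof (rule ccontr)
  assume "g x \<noteq> 0"
  then have "Re (\<mu> (\<lambda>x. of_real ((cmod (g x))\<^sup>2))) > 0"
    using g by (intro \<mu>_positive[where x = x]) (auto simp: cfun_iff intro!: continuous_intros)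
  moreover have "complex_of_real ((cmod (g x))\<^sup>2) = g x * cnj (g x)" for x
    by (rule complex_norm_square)
  ultimately show False
    using orth[OF cfun_cnj[OF g]] by simp
qed

definition unit_bump :: "'q set \<Rightarrow> ('q \<Rightarrow> real) \<Rightarrow> bool"
  where "unit_bump W k \<longleftrightarrow> continuous_on UNIV k \<and> (\<forall>y. k y \<ge> 0) \<and> (\<forall>y. y \<notin> W \<longrightarrow> k y = 0) \<and>
    \<mu> (\<lambda>y. of_real (k y)) = 1"

lemma unit_bump_mono: "unit_bump W k \<Longrightarrow> W \<subseteq> U \<Longrightarrow> unit_bump U k"
  by (auto simp: unit_bump_def)

text \<open>
  By invariance \<open>k (dag x * z)\<close> has integral one in \<open>x\<close> as well as in \<open>z\<close>, and it vanishes unless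
  \<open>f x\<close> and \<open>f z\<close> are close. The second estimate integrates over the other variable, with
  \<open>dag x\<close> in place of \<open>x\<close>.
\<close>

lemma approximate_identity:
  assumes f: "f \<in> cfun" and "\<epsilon> > 0"
  obtains W where "open W" "e \<in> W"
    "\<And>k z. unit_bump W k \<Longrightarrow> cmod (f z - \<mu> (\<lambda>x. f x * pc (dag x) z (\<lambda>y. of_real (k y)))) \<le> \<epsilon>"
    "\<And>k x. unit_bump W k \<Longrightarrow> cmod (f (dag x) - \<mu> (\<lambda>z. f z * pc x z (\<lambda>y. of_real (k y)))) \<le> \<epsilon>"
proof -
  obtain W where W: "open W" "e \<in> W" "\<And>k x z. k \<in> cfun \<Longrightarrow> (\<And>y. y \<notin> W \<Longrightarrow> k y = 0) \<Longrightarrow>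
    \<epsilon> \<le> cmod (f x - f z) \<Longrightarrow> pc (dag x) z k = 0"
    using convolution_vanishes_off_diagonal[OF assms] by metis
  \<comment> \<open>The common core of both estimates: an average of \<open>f\<close> with a weight of mass one that
    vanishes where \<open>f\<close> is not close to \<open>c\<close>.\<close>
  have weighted: "cmod (c - \<mu> (\<lambda>u. f u * pc (a u) (b u) (\<lambda>y. of_real (k y)))) \<le> \<epsilon>"
    if k: "continuous_on UNIV k" "\<And>y. k y \<ge> (0::real)"
      and ab: "continuous_on UNIV a" "continuous_on UNIV b"
      and one: "\<mu> (\<lambda>u. pc (a u) (b u) (\<lambda>y. of_real (k y))) = 1"
      and near: "\<And>u. \<epsilon> \<le> cmod (f u - c) \<Longrightarrow> pc (a u) (b u) (\<lambda>y. of_real (k y)) = 0"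
    for k a b c
  proof -
    define p where "p u = Re (pc (a u) (b u) (\<lambda>y. of_real (k y)))" for u
    have p_eq: "pc (a u) (b u) (\<lambda>y. of_real (k y)) = complex_of_real (p u)" for u
      unfolding p_def by (rule pc_of_real(1)[OF k, symmetric])
    have p_nonneg: "p u \<ge> 0" for u
      unfolding p_def by (rule pc_of_real(2)[OF k])
    have "(\<lambda>u. complex_of_real (p u)) \<in> cfun"
      unfolding p_eq[symmetric] by (rule pc_cfun[OF cfun_of_real[OF k(1)] ab])
    then have p: "continuous_on UNIV p"
      using continuous_on_Re[of UNIV "\<lambda>u. complex_of_real (p u)"] by (simp add: cfun_iff)
    note pc = cfun_of_real[OF p]
    have "cmod (c - \<mu> (\<lambda>u. f u * of_real (p u))) = cmod (\<mu> (\<lambda>u. c * of_real (p u) - f u * of_real (p u)))"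
      using one by (simp add: radon_diff[OF \<mu>_radon cfun_mult[OF cfun_const pc] cfun_mult[OF f pc]]
          radon_scale[OF \<mu>_radon pc] p_eq)
    also have "\<dots> \<le> Re (\<mu> (\<lambda>u. of_real (\<epsilon> * p u)))"
    proof (rule probability_dominated[OF compact_space \<mu>_prob])
      show "(\<lambda>u. c * of_real (p u) - f u * of_real (p u)) \<in> cfun"
        by (intro cfun_diff cfun_mult cfun_const f pc)
      show "continuous_on UNIV (\<lambda>u. \<epsilon> * p u)" by (intro continuous_intros p)
      fix u
      have "cmod (c * of_real (p u) - f u * of_real (p u)) = cmod (f u - c) * p u"
        using p_nonneg[of u] by (simp add: norm_mult norm_minus_commute flip: left_diff_distrib)
      also have "\<dots> \<le> \<epsilon> * p u"
        using near[of u] p_nonneg[of u]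
        by (cases "\<epsilon> \<le> cmod (f u - c)") (auto simp: p_eq intro: mult_right_mono)
      finally show "cmod (c * of_real (p u) - f u * of_real (p u)) \<le> \<epsilon> * p u" .
    qed
    also have "\<mu> (\<lambda>u. of_real (\<epsilon> * p u)) = of_real \<epsilon>"
      using one by (simp add: radon_scale[OF \<mu>_radon pc] p_eq)
    finally show ?thesis by (simp add: p_eq)
  qed
  show ?thesis
  proof (rule that[OF W(1,2)])
    fix k :: "'q \<Rightarrow> real" and z :: 'q
    assume "unit_bump W k"
    then have k: "continuous_on UNIV k" "\<And>y. k y \<ge> 0" "\<And>y. y \<notin> W \<Longrightarrow> k y = 0"
      and one: "\<mu> (\<lambda>y. of_real (k y)) = 1"
      by (auto simp: unit_bump_def)
    note kc = cfun_of_real[OF k(1)]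
    have vanish: "pc (dag x) z (\<lambda>y. of_real (k y)) = 0" if "\<epsilon> \<le> cmod (f x - f z)" for x z
      using W(3)[OF kc _ that] k(3) by simp
    show "cmod (f z - \<mu> (\<lambda>x. f x * pc (dag x) z (\<lambda>y. of_real (k y)))) \<le> \<epsilon>"
      using one \<mu>_dag[OF pc_cfun_left[OF kc]] \<mu>_right[OF kc]
      by (intro weighted[OF k(1,2) dag_continuous continuous_on_const] vanish) auto
    have "pc z y (\<lambda>y. of_real (k y)) = 0" if "\<epsilon> \<le> cmod (f y - f (dag z))" for y
      using vanish[of "dag z" y] that by (simp add: dag_dag norm_minus_commute)
    then show "cmod (f (dag z) - \<mu> (\<lambda>y. f y * pc z y (\<lambda>y. of_real (k y)))) \<le> \<epsilon>"
      using one \<mu>_left[OF kc]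
      by (intro weighted[OF k(1,2) continuous_on_const continuous_on_id]) auto
  qed
qed

lemma unit_bump_normalise:
  assumes h: "continuous_on UNIV h" "\<And>y. 0 \<le> h y" "h e > 0" "\<And>y. y \<notin> W \<Longrightarrow> h y = 0"
  shows "\<exists>\<kappa>. unit_bump W (\<lambda>y. h y / \<kappa>)"
proof -
  define \<kappa> where "\<kappa> = Re (\<mu> (\<lambda>y. of_real (h y)))"
  have "\<kappa> > 0"
    unfolding \<kappa>_def by (rule \<mu>_positive_at_neutral[OF h(1-3)])
  moreover have "\<mu> (\<lambda>y. of_real (h y)) = of_real \<kappa>"
    using probability_nonneg(2)[OF compact_space \<mu>_prob h(1,2)] by (simp add: \<kappa>_def complex_eq_iff)
  ultimately have "\<mu> (\<lambda>y. of_real (h y / \<kappa>)) = 1"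
    using radon_scale_right[OF \<mu>_radon cfun_of_real[OF h(1)], of "of_real (inverse \<kappa>)"]
    by (simp add: divide_inverse)
  moreover have "continuous_on UNIV (\<lambda>y. h y / \<kappa>)"
    using \<open>\<kappa> > 0\<close> by (intro continuous_intros h) auto
  ultimately show ?thesis
    using h \<open>\<kappa> > 0\<close> by (auto simp: unit_bump_def)
qed

lemma unit_bump_exists:
  assumes "open W" "e \<in> W"
  obtains k where "unit_bump W k"
proof -
  have "closed (- W)" "{e} \<inter> - W = {}" using assms by auto
  from urysohn[OF compact_space closed_singleton this]
  obtain h where "continuous_on UNIV h" "\<And>y. 0 \<le> h y" "h e = (1::real)" "\<And>y. y \<notin> W \<Longrightarrow> h y = 0"
    by (metis Compl_iff singletonI)
  with unit_bump_normalise[of h W] that show ?thesis by auto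
qed

text \<open>
  Replace \<open>f\<close> on the left by its approximation with kernel \<open>k (dag w * z)\<close>. By associativity the
  same triple product \<open>k (dag w * x * z)\<close> arises from the approximation of \<open>g\<close> on the right.
\<close>

theorem translation_adjoint:
  assumes f: "f \<in> cfun" and g: "g \<in> cfun"
  shows "\<mu> (\<lambda>z. pc x z f * g z) = \<mu> (\<lambda>w. f w * pc (dag x) w g)"
proof -
  obtain c where c: "c \<ge> 0" "\<And>z. cmod (f z) \<le> c" using cfun_bounded[OF compact_space f] by metis
  obtain d where d: "d \<ge> 0" "\<And>z. cmod (g z) \<le> d" using cfun_bounded[OF compact_space g] by metis
  have close: "cmod (\<mu> (\<lambda>z. pc x z f * g z) - \<mu> (\<lambda>w. f w * pc (dag x) w g)) \<le> \<epsilon> * (c + d)"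
    if pos: "\<epsilon> > 0" for \<epsilon>
  proof -
    obtain U where U: "open U" "e \<in> U" "\<And>k z. unit_bump U k \<Longrightarrow>
        cmod (f z - \<mu> (\<lambda>x. f x * pc (dag x) z (\<lambda>y. of_real (k y)))) \<le> \<epsilon>"
      by (rule approximate_identity[OF f pos]) (rule that; blast)
    obtain V where V: "open V" "e \<in> V" "\<And>k x. unit_bump V k \<Longrightarrow>
        cmod (g (dag x) - \<mu> (\<lambda>z. g z * pc x z (\<lambda>y. of_real (k y)))) \<le> \<epsilon>"
      by (rule approximate_identity[OF g pos]) (rule that; blast)
    obtain kr where kr: "unit_bump (U \<inter> V) kr"
      using unit_bump_exists[of "U \<inter> V"] U(1,2) V(1,2) by blast
    define k where "k y = complex_of_real (kr y)" for y
    have k: "k \<in> cfun" unfolding k_def using kr by (intro cfun_of_real) (simp add: unit_bump_def)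
    have f_close: "cmod (f v - \<mu> (\<lambda>w. f w * pc (dag w) v k)) \<le> \<epsilon>" for v
      using U(3)[OF unit_bump_mono[OF kr]] by (simp add: k_def[abs_def])
    have g_close: "cmod (g (dag s) - \<mu> (\<lambda>z. g z * pc s z k)) \<le> \<epsilon>" for s
      using V(3)[OF unit_bump_mono[OF kr]] by (simp add: k_def[abs_def])
    define J where "J w z = pc x z (\<lambda>v. pc (dag w) v k)" for w z
    have J_eq: "J w z = pc (dag w) x (\<lambda>s. pc s z k)" for w z
      unfolding J_def by (rule pc_assoc[OF k, symmetric])
    have kw: "(\<lambda>p. pc (dag (snd p)) (fst p) k) \<in> cfun"
      by (intro pc_cfun k continuous_on_dag continuous_intros)
    have J: "(\<lambda>p. J (snd p) (fst p)) \<in> cfun"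
      using kernel_slice_left[OF compact_space pc_kernel_of[OF continuous_on_const continuous_on_id] kw]
      by (simp add: J_def case_prod_unfold)
    define fk where "fk v = \<mu> (\<lambda>w. f w * pc (dag w) v k)" for v
    have fkw: "(\<lambda>p. f (snd p) * pc (dag (snd p)) (fst p) k) \<in> cfun"
      by (intro cfun_mult kw cfun_compose[OF f] continuous_intros)
    have fk: "fk \<in> cfun"
      using measure_slice_right[OF compact_space \<mu>_radon fkw] by (simp add: fk_def[abs_def])
    define gk where "gk s = \<mu> (\<lambda>z. g z * pc s z k)" for s
    have gkz: "(\<lambda>p. g (snd p) * pc (fst p) (snd p) k) \<in> cfun"
      by (intro cfun_mult kernel_cfun[OF pc_kernel] k cfun_compose[OF g] continuous_intros)
    have gk: "gk \<in> cfun"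
      using measure_slice_right[OF compact_space \<mu>_radon gkz] by (simp add: gk_def[abs_def])
    have pc_fk: "pc x z fk = \<mu> (\<lambda>w. f w * J w z)" for z
    proof -
      have "pc x z fk = \<mu> (\<lambda>w. pc x z (\<lambda>v. f w * pc (dag w) v k))"
        using fubini[OF compact_space compact_space pc_radon \<mu>_radon fkw, of x z]
        by (simp add: fk_def[abs_def])
      then show ?thesis
        by (simp add: J_def radon_scale[OF pc_radon pc_cfun_right[OF k]])
    qed
    have pc_gk: "pc (dag w) x gk = \<mu> (\<lambda>z. g z * J w z)" for w
    proof -
      have "pc (dag w) x gk = \<mu> (\<lambda>z. pc (dag w) x (\<lambda>s. g z * pc s z k))"
        using fubini[OF compact_space compact_space pc_radon \<mu>_radon gkz, of "dag w" x]
        by (simp add: gk_def[abs_def])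
      then show ?thesis
        by (simp add: J_eq radon_scale[OF pc_radon pc_cfun_left[OF k]])
    qed
    have Jw: "(\<lambda>w. J w z) \<in> cfun" and Jz: "(\<lambda>z. J w z) \<in> cfun" for w z
      using cfun_slice_right[OF J, of z] cfun_slice_left[OF J, of w] by simp_all
    have "(\<lambda>p. g (fst p) * (f (snd p) * J (snd p) (fst p))) \<in> cfun"
      by (intro cfun_mult J cfun_compose[OF g] cfun_compose[OF f] continuous_intros)
    from fubini[OF compact_space compact_space \<mu>_radon \<mu>_radon this]
    have "\<mu> (\<lambda>z. \<mu> (\<lambda>w. g z * (f w * J w z))) = \<mu> (\<lambda>w. \<mu> (\<lambda>z. g z * (f w * J w z)))"
      by simp
    moreover have "\<mu> (\<lambda>w. g z * (f w * J w z)) = g z * \<mu> (\<lambda>w. f w * J w z)" for z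
      by (rule radon_scale[OF \<mu>_radon cfun_mult[OF f Jw]])
    moreover have "\<mu> (\<lambda>z. g z * (f w * J w z)) = f w * \<mu> (\<lambda>z. g z * J w z)" for w
      using radon_scale[OF \<mu>_radon cfun_mult[OF g Jz], of "f w" w] by (simp add: mult.left_commute)
    ultimately have "\<mu> (\<lambda>z. g z * \<mu> (\<lambda>w. f w * J w z)) = \<mu> (\<lambda>w. f w * \<mu> (\<lambda>z. g z * J w z))"
      by simp
    then have middle: "\<mu> (\<lambda>z. pc x z fk * g z) = \<mu> (\<lambda>w. f w * pc (dag w) x gk)"
      by (simp add: pc_fk pc_gk mult.commute)
    have "cmod (pc x z f - pc x z fk) \<le> \<epsilon>" for z
      using f_close by (intro probability_close[OF compact_space pc_prob f fk]) (simp add: fk_def)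
    then have "cmod (pc x z f * g z - pc x z fk * g z) \<le> \<epsilon> * d" for z
      using d pos by (simp add: norm_mult mult_mono' flip: left_diff_distrib)
    then have left: "cmod (\<mu> (\<lambda>z. pc x z f * g z) - \<mu> (\<lambda>z. pc x z fk * g z)) \<le> \<epsilon> * d"
      by (intro probability_close[OF compact_space \<mu>_prob] cfun_mult pc_cfun_right f fk g)
    have "cmod (pc (dag w) x gk - pc (dag x) w g) \<le> \<epsilon>" for w
    proof -
      have "pc (dag x) w g = pc (dag w) x (\<lambda>s. g (dag s))"
        by (simp add: pc_dag[OF g] dag_dag)
      moreover have "cmod (pc (dag w) x (\<lambda>s. g (dag s)) - pc (dag w) x gk) \<le> \<epsilon>"
        using g_close
        by (intro probability_close[OF compact_space pc_prob cfun_dag[OF g] gk]) (simp add: gk_def)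
      ultimately show ?thesis by (simp add: norm_minus_commute)
    qed
    then have "cmod (f w * pc (dag w) x gk - f w * pc (dag x) w g) \<le> c * \<epsilon>" for w
      using c pos by (simp add: norm_mult mult_mono' flip: right_diff_distrib)
    then have right: "cmod (\<mu> (\<lambda>w. f w * pc (dag w) x gk) - \<mu> (\<lambda>w. f w * pc (dag x) w g)) \<le> c * \<epsilon>"
      by (intro probability_close[OF compact_space \<mu>_prob] cfun_mult pc_cfun_right f g
          pc_cfun[OF gk dag_continuous continuous_on_const])
    show ?thesis
      using norm_triangle_le[OF add_mono[OF left right[folded middle]]]
      by (simp add: algebra_simps)
  qed
  have "\<mu> (\<lambda>z. pc x z f * g z) - \<mu> (\<lambda>w. f w * pc (dag x) w g) = 0"
  proof (rule cmod_eq_0_by_bounds)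
    fix \<epsilon> :: real assume "\<epsilon> > 0"
    then have "\<epsilon> / (c + d + 1) > 0" using c(1) d(1) by simp
    from close[OF this] show "cmod (\<mu> (\<lambda>z. pc x z f * g z) - \<mu> (\<lambda>w. f w * pc (dag x) w g)) \<le> \<epsilon>"
    proof (rule order_trans)
      show "\<epsilon> / (c + d + 1) * (c + d) \<le> \<epsilon>"
        using c(1) d(1) \<open>\<epsilon> > 0\<close> by (simp add: field_simps)
    qed
  qed
  then show ?thesis by simp
qed

end

section \<open>Orbital mappings\<close>

locale orbital_hypergroup = compact_hypergroup_with_haar pc dag e \<mu>
  for pc :: "'q::t2_space \<Rightarrow> 'q \<Rightarrow> 'q functional" and dag e \<mu> +
  fixes \<phi> :: "'q \<Rightarrow> 'y::t2_space" and q :: "'y \<Rightarrow> 'q functional"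
  assumes orbital: "orbital_mapping \<phi>"
    and neutral_orbit: "\<phi> -` {\<phi> e} = {e}"
    and dag_orbit: "A \<in> orbits \<phi> \<Longrightarrow> dag ` A \<in> orbits \<phi>"
    and q_prob: "probability_measure (q y)"
    and q_support: "msupport (q y) \<subseteq> \<phi> -` {y}"
begin

abbreviation B :: "('q \<Rightarrow> complex) set"
  where "B \<equiv> orbit_subalgebra \<phi>"

text \<open>The averaging operator \<open>P\<close>.\<close>

abbreviation E :: "('q \<Rightarrow> complex) \<Rightarrow> ('q \<Rightarrow> complex)"
  where "E \<equiv> (\<lambda>f x. q (\<phi> x) f)"

lemma \<phi>_continuous: "continuous_on UNIV \<phi>"
  and \<phi>_open: "open U \<Longrightarrow> open (\<phi> ` U)"
  and \<phi>_surj: "surj \<phi>"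
  using orbital by (auto simp: orbital_mapping_def)

lemma compact_orbit_space: "compact (UNIV :: 'y set)"
  using compact_continuous_image[OF \<phi>_continuous compact_space] \<phi>_surj by simp

lemma q_radon: "q y \<in> radon_measures"
  by (rule probability_radon[OF q_prob])

lemma B_cfun: "b \<in> B \<Longrightarrow> b \<in> cfun"
  by (simp add: orbit_subalgebra_def)

lemma B_eq:
  assumes "b \<in> B" "\<phi> x = \<phi> y"
  shows "b x = b y"
proof -
  have "b constant_on \<phi> -` {\<phi> y}"
    using assms(1) by (auto simp: orbit_subalgebra_def orbits_def)
  then show ?thesis using assms(2) by (auto simp: constant_on_def)
qed

lemma BI:
  assumes "b \<in> cfun" "\<And>x y. \<phi> x = \<phi> y \<Longrightarrow> b x = b y"
  shows "b \<in> B"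
proof -
  have "b constant_on A" if "A \<in> orbits \<phi>" for A
  proof -
    obtain y where A: "A = \<phi> -` {y}" using \<open>A \<in> orbits \<phi>\<close> by (auto simp: orbits_def)
    obtain x where "\<phi> x = y" using \<phi>_surj by (metis surjD)
    then have "\<forall>z\<in>A. b z = b x" using assms(2) A by simp
    then show ?thesis unfolding constant_on_def by blast
  qed
  then show ?thesis using assms(1) by (simp add: orbit_subalgebra_def)
qed

lemma compose_\<phi>_B: "h \<in> cfun \<Longrightarrow> h \<circ> \<phi> \<in> B"
  by (rule BI) (simp_all add: comp_def cfun_compose[OF _ \<phi>_continuous])

text \<open>As \<open>\<phi>\<close> is open, the topology of the orbit space is the quotient topology.\<close>

lemma B_factors:
  assumes "b \<in> B"
  obtains h where "h \<in> cfun" "b = h \<circ> \<phi>"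
proof
  define h where "h y = b (inv \<phi> y)" for y
  show b: "b = h \<circ> \<phi>"
  proof
    show "b x = (h \<circ> \<phi>) x" for x
      unfolding h_def comp_def by (rule B_eq[OF assms]) (simp add: f_inv_into_f)
  qed
  have "open (h -` U)" if "open U" for U
  proof -
    have "h -` U = \<phi> ` (b -` U)"
    proof (intro equalityI subsetI)
      show "y \<in> \<phi> ` (b -` U)" if "y \<in> h -` U" for y
        using that \<phi>_surj by (intro image_eqI[of _ _ "inv \<phi> y"]) (auto simp: b surj_f_inv_f)
    qed (auto simp: b)
    moreover have "open (b -` U)"
      using B_cfun[OF assms] open_vimage[OF that] by (simp add: cfun_iff)
    ultimately show ?thesis by (simp add: \<phi>_open)
  qed
  then show "h \<in> cfun"
    by (simp add: cfun_iff continuous_on_open_vimage)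
qed

lemma zero_pushforward_iff: "zero_measure (pushforward \<phi> \<nu>) \<longleftrightarrow> (\<forall>b\<in>B. \<nu> b = 0)"
proof
  assume zero: "zero_measure (pushforward \<phi> \<nu>)"
  show "\<forall>b\<in>B. \<nu> b = 0"
  proof
    fix b assume "b \<in> B"
    then obtain h where "h \<in> cfun" "b = h \<circ> \<phi>" by (rule B_factors)
    then show "\<nu> b = 0" using zero by (simp add: zero_measure_def pushforward_def)
  qed
qed (simp add: zero_measure_def pushforward_def compose_\<phi>_B)

lemma phi_consistent_iff:
  "phi_consistent pc \<phi> m \<longleftrightarrow> m \<in> radon_measures \<and> (\<forall>\<nu>\<in>radon_measures. (\<forall>b\<in>B. \<nu> b = 0) \<longrightarrow>
    (\<forall>b\<in>B. conv pc m \<nu> b = 0) \<and> (\<forall>b\<in>B. conv pc \<nu> m b = 0))"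
  by (simp add: phi_consistent_def zero_pushforward_iff)

lemma dag_same_orbit:
  assumes "\<phi> x = \<phi> y"
  shows "\<phi> (dag x) = \<phi> (dag y)"
proof -
  have "dag ` (\<phi> -` {\<phi> y}) \<in> orbits \<phi>"
    by (rule dag_orbit) (auto simp: orbits_def)
  then obtain z where "dag ` (\<phi> -` {\<phi> y}) = \<phi> -` {z}" by (auto simp: orbits_def)
  moreover have "dag x \<in> dag ` (\<phi> -` {\<phi> y})" "dag y \<in> dag ` (\<phi> -` {\<phi> y})"
    using assms by auto
  ultimately show ?thesis by simp
qed

lemma B_dag: "b \<in> B \<Longrightarrow> (\<lambda>x. b (dag x)) \<in> B"
  by (rule BI[OF cfun_dag[OF B_cfun]]) (assumption, rule B_eq[OF _ dag_same_orbit])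

lemma q_const_on_orbit:
  "f \<in> cfun \<Longrightarrow> (\<And>z. \<phi> z = y \<Longrightarrow> f z = c) \<Longrightarrow> q y f = c"
  using q_support by (intro probability_const_on_support[OF compact_space q_prob]) blast+

lemma q_B: "b \<in> B \<Longrightarrow> q (\<phi> x) b = b x"
  by (rule q_const_on_orbit[OF B_cfun]) (assumption, rule B_eq)

lemma q_neutral: "f \<in> cfun \<Longrightarrow> q (\<phi> e) f = f e"
proof (rule q_const_on_orbit)
  show "f z = f e" if "\<phi> z = \<phi> e" for z
    using that neutral_orbit by auto
qed

lemma q_module:
  assumes "b \<in> B" "f \<in> cfun"
  shows "q (\<phi> x) (\<lambda>z. b z * f z) = b x * q (\<phi> x) f"
proof -
  have "q (\<phi> x) (\<lambda>z. b z * f z - b x * f z) = 0"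
  proof (rule q_const_on_orbit)
    show "(\<lambda>z. b z * f z - b x * f z) \<in> cfun"
      using B_cfun[OF assms(1)] assms(2) by (intro cfun_diff cfun_mult cfun_const)
    show "b z * f z - b x * f z = 0" if "\<phi> z = \<phi> x" for z
      using B_eq[OF assms(1) that] by simp
  qed
  then show ?thesis
    by (simp add: radon_diff[OF q_radon cfun_mult[OF B_cfun[OF assms(1)] assms(2)]
          cfun_mult[OF cfun_const assms(2)]] radon_scale[OF q_radon assms(2)])
qed

lemma E_in_B: "E f \<in> cfun \<Longrightarrow> E f \<in> B"
  by (rule BI) simp_all

lemma conditional_expectation_E:
  assumes cont: "\<And>f. f \<in> cfun \<Longrightarrow> E f \<in> cfun"
  shows "conditional_expectation B E"
proof -
  have "linear_op E"
    unfolding linear_op_def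
    by (auto simp: cont radon_add[OF q_radon] radon_scale[OF q_radon])
  moreover have "\<forall>b\<in>B. E b = b" by (simp add: q_B)
  moreover have "\<forall>f\<in>cfun. (\<forall>x. f x \<in> \<real>\<^sub>\<ge>\<^sub>0) \<longrightarrow> (\<forall>x. E f x \<in> \<real>\<^sub>\<ge>\<^sub>0)"
    using q_prob by (simp add: probability_measure_def)
  moreover have "\<forall>f\<in>cfun. sup_norm (E f) \<le> sup_norm f"
    by (intro ballI sup_norm_le probability_bound[OF compact_space q_prob]
        cmod_le_sup_norm[OF compact_space])
  moreover have "E (\<lambda>x. b x * f x * b' x) = (\<lambda>x. b x * E f x * b' x)"
    if "b \<in> B" "b' \<in> B" "f \<in> cfun" for b b' f
  proof
    fix x
    have "q (\<phi> x) (\<lambda>x. b' x * (b x * f x)) = b' x * (b x * q (\<phi> x) f)"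
      by (simp add: q_module that cfun_mult B_cfun)
    then show "E (\<lambda>x. b x * f x * b' x) x = b x * E f x * b' x"
      by (simp add: mult_ac)
  qed
  ultimately show ?thesis
    unfolding conditional_expectation_def using E_in_B cont by blast
qed

text \<open>
  The orbit of \<open>e\<close> is a single point, so by compactness every neighbourhood of \<open>e\<close> contains one that
  is a union of orbits.
\<close>

lemma unit_bump_in_B:
  assumes "open W" "e \<in> W"
  obtains k where "unit_bump W k" "(\<lambda>y. complex_of_real (k y)) \<in> B"
proof -
  have "compact (- W)"
    using compact_Int_closed[OF compact_space, of "- W"] assms(1) by auto
  then have "closed (\<phi> ` (- W))"
    by (intro compact_imp_closed compact_continuous_image continuous_on_subset[OF \<phi>_continuous]) auto
  moreover have "{\<phi> e} \<inter> \<phi> ` (- W) = {}"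
    using neutral_orbit assms(2) by auto
  ultimately obtain h where h: "continuous_on UNIV h" "\<And>y. 0 \<le> h y" "\<And>y. h y \<le> (1::real)"
    "\<And>y. y \<in> {\<phi> e} \<Longrightarrow> h y = 1" "\<And>y. y \<in> \<phi> ` (- W) \<Longrightarrow> h y = 0"
    using urysohn[OF compact_orbit_space closed_singleton] by blast
  have "continuous_on UNIV (\<lambda>x. h (\<phi> x))"
    using continuous_on_compose2[OF h(1) \<phi>_continuous] by simp
  then have "\<exists>\<kappa>. unit_bump W (\<lambda>x. h (\<phi> x) / \<kappa>)"
    by (rule unit_bump_normalise) (use h in auto)
  then obtain \<kappa> where k: "unit_bump W (\<lambda>x. h (\<phi> x) / \<kappa>)" ..
  moreover have "(\<lambda>x. complex_of_real (h (\<phi> x) / \<kappa>)) \<in> B"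
    using k by (intro BI cfun_of_real) (auto simp: unit_bump_def)
  ultimately show ?thesis by (rule that)
qed

text \<open>
  Translates of functions in \<open>B\<close> are dense in \<open>C(Q)\<close>: with a bump \<open>k\<close> in \<open>B\<close>, the kernel
  \<open>k (dag x * z)\<close> of an approximate identity is a translate of \<open>k\<close> for each \<open>x\<close>.
\<close>

lemma approximation_by_translates:
  assumes f: "f \<in> cfun" and "\<epsilon> > 0"
  obtains k where "k \<in> B" "\<And>z. cmod (f z - \<mu> (\<lambda>x. f x * pc (dag x) z k)) \<le> \<epsilon>"
proof -
  obtain W where W: "open W" "e \<in> W" "\<And>k z. unit_bump W k \<Longrightarrow>
      cmod (f z - \<mu> (\<lambda>x. f x * pc (dag x) z (\<lambda>y. of_real (k y)))) \<le> \<epsilon>"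
    by (rule approximate_identity[OF assms]) (rule that; blast)
  obtain k where "unit_bump W k" "(\<lambda>y. complex_of_real (k y)) \<in> B"
    using unit_bump_in_B[OF W(1,2)] .
  then show ?thesis using W(3) that by blast
qed

text \<open>
  Integration of an approximation against \<open>\<nu>\<close> involves only the integrals of translates of \<open>k\<close>.
\<close>

lemma approximation_kernel:
  assumes f: "f \<in> cfun" and k: "k \<in> cfun" and \<nu>: "\<nu> \<in> radon_measures"
  shows "(\<lambda>z. \<mu> (\<lambda>x. f x * pc (dag x) z k)) \<in> cfun"
    and "\<nu> (\<lambda>z. \<mu> (\<lambda>x. f x * pc (dag x) z k)) = \<mu> (\<lambda>x. f x * \<nu> (\<lambda>z. pc (dag x) z k))"
proof -
  have F: "(\<lambda>p. f (snd p) * pc (dag (snd p)) (fst p) k) \<in> cfun"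
    by (intro cfun_mult pc_cfun k cfun_compose[OF f] continuous_on_dag continuous_intros)
  show "(\<lambda>z. \<mu> (\<lambda>x. f x * pc (dag x) z k)) \<in> cfun"
    using measure_slice_right[OF compact_space \<mu>_radon F] by simp
  show "\<nu> (\<lambda>z. \<mu> (\<lambda>x. f x * pc (dag x) z k)) = \<mu> (\<lambda>x. f x * \<nu> (\<lambda>z. pc (dag x) z k))"
    using fubini[OF compact_space compact_space \<nu> \<mu>_radon F]
    by (simp add: radon_scale[OF \<nu> pc_cfun_right[OF k]])
qed

lemma zero_on_translates:
  assumes \<nu>: "\<nu> \<in> radon_measures" and zero: "\<And>x k. k \<in> B \<Longrightarrow> \<nu> (\<lambda>z. pc x z k) = 0"
    and f: "f \<in> cfun"
  shows "\<nu> f = 0"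
proof (rule radon_eqI[OF compact_space \<nu> f])
  fix \<epsilon> :: real assume "\<epsilon> > 0"
  then obtain k where k: "k \<in> B" "\<And>z. cmod (f z - \<mu> (\<lambda>x. f x * pc (dag x) z k)) \<le> \<epsilon>"
    using approximation_by_translates[OF f] by blast
  have "\<nu> (\<lambda>z. \<mu> (\<lambda>x. f x * pc (dag x) z k)) = 0"
    unfolding approximation_kernel(2)[OF f B_cfun[OF k(1)] \<nu>] zero[OF k(1)]
    by (simp add: radon_zero[OF \<mu>_radon])
  then show "\<exists>g\<in>cfun. \<nu> g = 0 \<and> (\<forall>z. cmod (f z - g z) \<le> \<epsilon>)"
    using approximation_kernel(1)[OF f B_cfun[OF k(1)] \<nu>] k(2) by blast
qed

lemma conv_q: "conv pc (q y) (q y') f = q y (\<lambda>u. q y' (\<lambda>v. pc u v f))"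
  by (simp add: conv_def comult_def)

lemma conv_slice_cfun: "m \<in> radon_measures \<Longrightarrow> f \<in> cfun \<Longrightarrow> (\<lambda>u. m (\<lambda>v. pc u v f)) \<in> cfun"
  using measure_slice_right[OF compact_space _ kernel_cfun[OF pc_kernel]] by simp

lemma conv_fubini:
  "\<nu> \<in> radon_measures \<Longrightarrow> m \<in> radon_measures \<Longrightarrow> f \<in> cfun \<Longrightarrow>
    conv pc \<nu> m f = m (\<lambda>y. \<nu> (\<lambda>x. pc x y f))"
  using fubini[OF compact_space compact_space _ _ kernel_cfun[OF pc_kernel]]
  by (simp add: conv_def comult_def)

lemma op_tensor_op_E:
  assumes "radon_kernel (\<lambda>x. q (\<phi> x))" "f \<in> cfun"
  shows "op_tensor_op E E (comult pc f) = (\<lambda>(x, y). conv pc (q (\<phi> x)) (q (\<phi> y)) f)"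
  unfolding op_tensor_op_kernel[OF compact_space compact_space assms(1,1) pc_continuous[OF assms(2)]]
  by (simp add: conv_q comult_def)

section \<open>From consistent measures to the expectation\<close>

context
  assumes consistent: "\<And>y. phi_consistent pc \<phi> (q y)"
begin

lemma null_conv:
  assumes "phi_consistent pc \<phi> m" "\<nu> \<in> radon_measures" "\<And>b. b \<in> B \<Longrightarrow> \<nu> b = 0" "b \<in> B"
  shows "conv pc m \<nu> b = 0" "conv pc \<nu> m b = 0"
  using assms by (auto simp: phi_consistent_iff)

text \<open>\<open>\<delta>\<^sub>x\<close> and \<open>q (\<phi> x)\<close> have the same image in the orbit space.\<close>

lemma conv_dirac_eq_conv_q:
  assumes "phi_consistent pc \<phi> m" "b \<in> B"
  shows "conv pc (dirac x) m b = conv pc (q (\<phi> x)) m b"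
    and "conv pc m (dirac x) b = conv pc m (q (\<phi> x)) b"
proof -
  have m: "m \<in> radon_measures" using assms(1) by (simp add: phi_consistent_iff)
  have null: "(\<lambda>f. dirac x f - q (\<phi> x) f) \<in> radon_measures"
    "\<And>b. b \<in> B \<Longrightarrow> dirac x b - q (\<phi> x) b = 0"
    by (intro radon_diff_measure compact_space dirac_radon q_radon) (simp add: dirac_def q_B)
  show "conv pc (dirac x) m b = conv pc (q (\<phi> x)) m b"
    using null_conv(2)[OF assms(1) null assms(2)] by (simp add: conv_def)
  show "conv pc m (dirac x) b = conv pc m (q (\<phi> x)) b"
    using null_conv(1)[OF assms(1) null assms(2)]
    by (simp add: conv_diff_right[OF m dirac_radon q_radon B_cfun[OF assms(2)]])
qed

text \<open>Both sides are equal to the convolution of \<open>q (\<phi> x)\<close> and \<open>q (\<phi> z)\<close>, evaluated at \<open>k\<close>.\<close>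

lemma q_translate:
  assumes k: "k \<in> B"
  shows "q (\<phi> z) (\<lambda>v. pc x v k) = q (\<phi> x) (\<lambda>u. pc u z k)"
  using conv_dirac_eq_conv_q(1)[OF consistent k, of x "\<phi> z"]
    conv_dirac_eq_conv_q(2)[OF consistent k, of "\<phi> x" z]
  by (simp add: conv_dirac_left conv_dirac_right)

text \<open>
  It suffices to treat the approximations of \<open>f\<close> by superpositions of translates of \<open>k \<in> B\<close>. There
  the equality \<open>q_translate\<close> moves the dependence on \<open>z\<close> from the measure to the integrand.
\<close>

lemma E_continuous:
  assumes f: "f \<in> cfun"
  shows "E f \<in> cfun"
proof (rule cfun_uniform_limit)
  fix \<epsilon> :: real assume "\<epsilon> > 0"
  obtain k where k: "k \<in> B" "\<And>z. cmod (f z - \<mu> (\<lambda>x. f x * pc (dag x) z k)) \<le> \<epsilon>"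
    using approximation_by_translates[OF f \<open>\<epsilon> > 0\<close>] by blast
  note kc = B_cfun[OF k(1)]
  obtain c where c: "c \<ge> 0" "\<And>z. cmod (f z) \<le> c" using cfun_bounded[OF compact_space f] by metis
  define H where "H z x = q (\<phi> z) (\<lambda>v. pc (dag x) v k)" for z x
  have H_eq: "H z x = q (\<phi> (dag x)) (\<lambda>u. pc u z k)" for z x
    unfolding H_def by (rule q_translate[OF k(1)])
  have H: "H z \<in> cfun" for z
    using cfun_dag[OF conv_slice_cfun[OF q_radon kc]] by (simp add: H_def[abs_def])
  define g where "g z = \<mu> (\<lambda>x. f x * H z x)" for z
  have "g \<in> cfun"
  proof (rule cfun_neighbourhoodI)
    fix z and \<delta> :: real assume "\<delta> > 0"
    define \<eta> where "\<eta> = \<delta> / (c + 1)"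
    have "\<eta> > 0" "c * \<eta> < \<delta>"
      using c(1) \<open>\<delta> > 0\<close> by (auto simp: \<eta>_def field_simps)
    from uniform_slice[OF compact_space pc_continuous[OF kc] \<open>\<eta> > 0\<close>, of z]
    obtain V where V: "open V" "z \<in> V"
      "\<And>z' u. z' \<in> V \<Longrightarrow> cmod (comult pc k (u, z') - comult pc k (u, z)) \<le> \<eta>"
      by blast
    have "cmod (g z' - g z) < \<delta>" if "z' \<in> V" for z'
    proof -
      have "cmod (H z' x - H z x) \<le> \<eta>" for x
        unfolding H_eq
      proof (intro probability_close[OF compact_space q_prob] pc_cfun_left kc)
        show "cmod (pc u z' k - pc u z k) \<le> \<eta>" for u
          using V(3)[OF that, of u] by (simp add: comult_def)
      qed
      then have "cmod (f x * H z' x - f x * H z x) \<le> c * \<eta>" for x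
        using c \<open>\<eta> > 0\<close> by (simp add: norm_mult mult_mono' flip: right_diff_distrib)
      then have "cmod (g z' - g z) \<le> c * \<eta>"
        unfolding g_def by (intro probability_close[OF compact_space \<mu>_prob] cfun_mult f H)
      then show ?thesis using \<open>c * \<eta> < \<delta>\<close> by linarith
    qed
    then show "\<exists>W. open W \<and> z \<in> W \<and> (\<forall>w\<in>W. cmod (g w - g z) < \<delta>)"
      using V(1,2) by blast
  qed
  moreover have "cmod (E f z - g z) \<le> \<epsilon>" for z
  proof -
    have "g z = q (\<phi> z) (\<lambda>z. \<mu> (\<lambda>x. f x * pc (dag x) z k))"
      unfolding approximation_kernel(2)[OF f kc q_radon] by (simp add: g_def H_def)
    then show ?thesis
      using k(2)
      by (auto intro!: probability_close[OF compact_space q_prob f approximation_kernel(1)[OF f kc q_radon]])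
  qed
  ultimately show "\<exists>g\<in>cfun. \<forall>z. cmod (E f z - g z) \<le> \<epsilon>" by blast
qed

lemma E_kernel: "radon_kernel (\<lambda>x. q (\<phi> x))"
  by (rule kernel_probability[OF compact_space q_prob E_continuous])

lemma E_translate: "k \<in> B \<Longrightarrow> E (\<lambda>v. pc x v k) = (\<lambda>z. q (\<phi> x) (\<lambda>u. pc u z k))"
  by (simp add: q_translate)

text \<open>
  The difference \<open>\<nu>\<close> of the two measures annihilates \<open>B\<close>. Each of them satisfies
  \<open>conv_dirac_eq_conv_q\<close>, so on a translate of \<open>k \<in> B\<close> the value of \<open>\<nu>\<close> is that of
  \<open>q (\<phi> x) * \<nu>\<close> on \<open>k\<close>, which is zero because \<open>q (\<phi> x)\<close> is consistent.
\<close>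

lemma consistent_measure_unique:
  assumes m: "phi_consistent pc \<phi> m" and same: "\<And>b. b \<in> B \<Longrightarrow> m b = q y b" and f: "f \<in> cfun"
  shows "m f = q y f"
proof -
  have mr: "m \<in> radon_measures" using m by (simp add: phi_consistent_iff)
  define \<nu> where "\<nu> = (\<lambda>f. m f - q y f)"
  have \<nu>: "\<nu> \<in> radon_measures"
    unfolding \<nu>_def by (rule radon_diff_measure[OF compact_space mr q_radon])
  have "\<nu> (\<lambda>z. pc x z k) = 0" if k: "k \<in> B" for x k
  proof -
    have "\<nu> (\<lambda>z. pc x z k) = conv pc (q (\<phi> x)) m k - conv pc (q (\<phi> x)) (q y) k"
      using conv_dirac_eq_conv_q(1)[OF m k, of x] conv_dirac_eq_conv_q(1)[OF consistent k, of x y]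
      by (simp add: \<nu>_def conv_dirac_left)
    also have "\<dots> = conv pc (q (\<phi> x)) \<nu> k"
      unfolding \<nu>_def by (rule conv_diff_right[OF q_radon mr q_radon B_cfun[OF k], symmetric])
    also have "\<dots> = 0"
      by (rule null_conv(1)[OF consistent \<nu> _ k]) (simp add: \<nu>_def same)
    finally show ?thesis .
  qed
  then have "\<nu> f = 0" by (rule zero_on_translates[OF \<nu> _ f])
  then show ?thesis by (simp add: \<nu>_def)
qed

text \<open>The involution reverses convolutions and, by \<open>B_dag\<close>, preserves \<open>B\<close>.\<close>

lemma pushforward_dag_consistent:
  assumes m: "phi_consistent pc \<phi> m"
  shows "phi_consistent pc \<phi> (pushforward dag m)"
proof -
  have mr: "m \<in> radon_measures" using m by (simp add: phi_consistent_iff)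
  have "conv pc (pushforward dag m) \<nu> b = 0 \<and> conv pc \<nu> (pushforward dag m) b = 0"
    if \<nu>: "\<nu> \<in> radon_measures" "\<forall>b\<in>B. \<nu> b = 0" and b: "b \<in> B" for \<nu> b
  proof -
    define \<nu>' where "\<nu>' = pushforward dag \<nu>"
    have \<nu>': "\<nu>' \<in> radon_measures" "\<And>b. b \<in> B \<Longrightarrow> \<nu>' b = 0"
      using pushforward_dag_radon[OF \<nu>(1)] \<nu>(2) B_dag
      by (auto simp: \<nu>'_def pushforward_def comp_def)
    have "pushforward dag \<nu>' = \<nu>"
      by (simp add: \<nu>'_def pushforward_def comp_def dag_dag)
    then show ?thesis
      using conv_dag[OF \<nu>'(1) mr B_cfun[OF b]] conv_dag[OF mr \<nu>'(1) B_cfun[OF b]]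
        null_conv[OF m \<nu>' B_dag[OF b]] by simp
  qed
  then show ?thesis
    using pushforward_dag_radon[OF mr] by (simp add: phi_consistent_iff)
qed

lemma q_dag:
  assumes f: "f \<in> cfun"
  shows "q (\<phi> x) (\<lambda>z. f (dag z)) = q (\<phi> (dag x)) f"
proof -
  have "pushforward dag (q (\<phi> x)) b = q (\<phi> (dag x)) b" if "b \<in> B" for b
    using q_B[OF B_dag[OF that]] q_B[OF that] by (simp add: pushforward_def comp_def)
  from consistent_measure_unique[OF pushforward_dag_consistent[OF consistent] this f]
  show ?thesis by (simp add: pushforward_def comp_def)
qed

lemma E_star:
  assumes f: "f \<in> cfun"
  shows "E (star dag f) = star dag (E f)"
  by (simp add: star_def probability_cnj[OF compact_space q_prob cfun_dag[OF f]] q_dag[OF f])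

lemma \<mu>_E:
  assumes f: "f \<in> cfun"
  shows "\<mu> (E f) = \<mu> f"
proof -
  have \<nu>: "(\<lambda>f. \<mu> (E f) - \<mu> f) \<in> radon_measures"
    by (rule radon_diff_measure[OF compact_space
          kernel_bind[OF compact_space compact_space \<mu>_radon E_kernel] \<mu>_radon])
  have "\<mu> (E (\<lambda>z. pc x z k)) - \<mu> (\<lambda>z. pc x z k) = 0" if k: "k \<in> B" for x k
  proof -
    have "\<mu> (E (\<lambda>z. pc x z k)) = conv pc (q (\<phi> x)) \<mu> k"
      unfolding E_translate[OF k] by (rule conv_fubini[OF q_radon \<mu>_radon B_cfun[OF k], symmetric])
    then show ?thesis
      by (simp add: conv_def comult_def \<mu>_left[OF B_cfun[OF k]] probability_const[OF q_prob])
  qed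
  from zero_on_translates[OF \<nu> this f] show ?thesis by simp
qed

text \<open>
  On the translate of \<open>k \<in> B\<close> by \<open>x\<close> the two sides are the values at \<open>k\<close> of triple convolutions
  with \<open>\<delta>\<^sub>x\<close> and with \<open>q (\<phi> x)\<close> as first factor. Consistency of \<open>q y\<close> lets their difference \<open>\<rho>\<close>,
  taken before the last factor, annihilate \<open>B\<close>; consistency of \<open>q y'\<close> passes this on to \<open>\<rho> * q y'\<close>.
\<close>

lemma conv_q_E:
  assumes f: "f \<in> cfun"
  shows "conv pc (q y) (q y') f = conv pc (q y) (q y') (E f)"
proof -
  define m where "m = conv pc (q y) (q y')"
  have m: "m \<in> radon_measures" unfolding m_def by (rule conv_radon[OF q_radon q_radon])
  have \<nu>: "(\<lambda>f. m f - m (E f)) \<in> radon_measures"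
    by (rule radon_diff_measure[OF compact_space m
          kernel_bind[OF compact_space compact_space m E_kernel]])
  have "m (\<lambda>z. pc x z k) - m (E (\<lambda>z. pc x z k)) = 0" if k: "k \<in> B" for x k
  proof -
    note kc = B_cfun[OF k]
    define \<rho> where "\<rho> = (\<lambda>f. conv pc (dirac x) (q y) f - conv pc (q (\<phi> x)) (q y) f)"
    have \<rho>: "\<rho> \<in> radon_measures"
      unfolding \<rho>_def by (intro radon_diff_measure compact_space conv_radon dirac_radon q_radon)
    have "m (\<lambda>z. pc x z k) = conv pc (conv pc (dirac x) (q y)) (q y') k"
      unfolding m_def by (simp add: conv_assoc[OF dirac_radon q_radon q_radon kc] conv_dirac_left)
    moreover have "m (E (\<lambda>z. pc x z k)) = conv pc (conv pc (q (\<phi> x)) (q y)) (q y') k"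
      unfolding E_translate[OF k] conv_assoc[OF q_radon q_radon q_radon kc]
      using conv_fubini[OF q_radon m kc] by (simp add: m_def)
    ultimately have "m (\<lambda>z. pc x z k) - m (E (\<lambda>z. pc x z k)) = conv pc \<rho> (q y') k"
      by (simp add: conv_def \<rho>_def)
    also have "\<dots> = 0"
      by (rule null_conv(2)[OF consistent \<rho> _ k]) (simp add: \<rho>_def conv_dirac_eq_conv_q[OF consistent])
    finally show ?thesis .
  qed
  from zero_on_translates[OF \<nu> this f] show ?thesis by (simp add: m_def)
qed

lemma hypotheses_H_E: "hypotheses_H pc dag e \<mu> B E"
proof -
  note tensor = op_tensor_op_E[OF E_kernel]
  have cont: "(\<lambda>(x, y). conv pc (q (\<phi> x)) (q (\<phi> y)) f) \<in> cfun" if "f \<in> cfun" for f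
    using kernel_cfun[OF kernel_product[OF compact_space compact_space E_kernel E_kernel]
        pc_continuous[OF that]]
    by (simp add: product_measure_def conv_def case_prod_unfold)
  have "conv pc (q (\<phi> e)) (q (\<phi> y)) f = f y" "conv pc (q (\<phi> y)) (q (\<phi> e)) f = f y"
    if f: "f \<in> B" for f y
  proof -
    note fc = B_cfun[OF f]
    show "conv pc (q (\<phi> e)) (q (\<phi> y)) f = f y"
      by (simp add: conv_q q_neutral[OF conv_slice_cfun[OF q_radon fc]] neutral_left[OF fc]
          dirac_def q_B[OF f])
    show "conv pc (q (\<phi> y)) (q (\<phi> e)) f = f y"
      by (simp add: conv_q q_neutral[OF pc_cfun_right[OF fc]] neutral_right[OF fc] dirac_def q_B[OF f])
  qed
  then have "fun_tensor_id (dirac e) (op_tensor_op E E (comult pc f)) = f"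
    "id_tensor_fun (dirac e) (op_tensor_op E E (comult pc f)) = f" if "f \<in> B" for f
    using that cont[OF B_cfun[OF that]]
    by (simp_all add: tensor[OF B_cfun[OF that]] fun_tensor_id_dirac[OF compact_space compact_space]
        id_tensor_fun_dirac[OF compact_space compact_space])
  then show ?thesis
    unfolding hypotheses_H_def
    using E_star \<mu>_E conv_q_E by (simp add: tensor E_continuous)
qed

end

section \<open>From the expectation to consistent measures\<close>

context
  assumes expectation: "conditional_expectation B E" and H: "hypotheses_H pc dag e \<mu> B E"
begin

lemma E_cfun: "f \<in> cfun \<Longrightarrow> E f \<in> cfun"
  using expectation by (simp add: conditional_expectation_def linear_op_def)

lemma E_B: "f \<in> cfun \<Longrightarrow> E f \<in> B"
  by (rule E_in_B[OF E_cfun])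

lemma E_is_kernel: "radon_kernel (\<lambda>x. q (\<phi> x))"
  by (rule kernel_probability[OF compact_space q_prob E_cfun])

lemma \<mu>_invariant: "f \<in> cfun \<Longrightarrow> \<mu> (E f) = \<mu> f"
  using H by (simp add: hypotheses_H_def)

lemma conv_q_invariant:
  assumes "f \<in> cfun"
  shows "conv pc (q (\<phi> x)) (q (\<phi> y)) (E f) = conv pc (q (\<phi> x)) (q (\<phi> y)) f"
proof -
  have "op_tensor_op E E (comult pc f) = op_tensor_op E E (comult pc (E f))"
    using H assms by (simp add: hypotheses_H_def)
  then have "(\<lambda>(x, y). conv pc (q (\<phi> x)) (q (\<phi> y)) f) (x, y)
      = (\<lambda>(x, y). conv pc (q (\<phi> x)) (q (\<phi> y)) (E f)) (x, y)"
    unfolding op_tensor_op_E[OF E_is_kernel assms] op_tensor_op_E[OF E_is_kernel E_cfun[OF assms]]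
    by (rule fun_cong)
  then show ?thesis by simp
qed

lemma q_dag_invariant:
  assumes f: "f \<in> cfun"
  shows "q (\<phi> x) (\<lambda>z. f (dag z)) = q (\<phi> (dag x)) f"
proof -
  have "E (star dag f) x = star dag (E f) x"
    using H f unfolding hypotheses_H_def by metis
  then show ?thesis
    by (simp add: star_def probability_cnj[OF compact_space q_prob cfun_dag[OF f]])
qed

lemma \<mu>_mult_E:
  assumes "b \<in> B" "f \<in> cfun"
  shows "\<mu> (\<lambda>x. b x * f x) = \<mu> (\<lambda>x. b x * E f x)"
  using \<mu>_invariant[OF cfun_mult[OF B_cfun[OF assms(1)] assms(2)]] by (simp add: q_module assms)

text \<open>Both sides are equal to the integral of \<open>E f * E g\<close>.\<close>

lemma \<mu>_E_symmetric:
  assumes "f \<in> cfun" "g \<in> cfun"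
  shows "\<mu> (\<lambda>x. E f x * g x) = \<mu> (\<lambda>x. f x * E g x)"
  using \<mu>_mult_E[OF E_B[OF assms(1)] assms(2)] \<mu>_mult_E[OF E_B[OF assms(2)] assms(1)]
  by (simp add: mult.commute)

text \<open>
  The measures \<open>b \<mu>\<close> with \<open>b \<in> B\<close> are invariant under \<open>E\<close>, and by the compatibility of \<open>E\<close> with
  the comultiplication so is the convolution of two of them.
\<close>

lemma B_measures_conv_invariant:
  assumes a: "a \<in> B" and c: "c \<in> B" and f: "f \<in> cfun"
  shows "\<mu> (\<lambda>x. a x * \<mu> (\<lambda>y. c y * pc x y f)) = \<mu> (\<lambda>x. a x * \<mu> (\<lambda>y. c y * pc x y (E f)))"
proof -
  \<comment> \<open>Average the integrand over orbits, first in \<open>y\<close> against \<open>c\<close> and then in \<open>x\<close> against \<open>a\<close>.\<close>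
  have averaged: "\<mu> (\<lambda>x. a x * \<mu> (\<lambda>y. c y * pc x y f))
      = \<mu> (\<lambda>x. a x * \<mu> (\<lambda>y. c y * conv pc (q (\<phi> x)) (q (\<phi> y)) f))"
    if f: "f \<in> cfun" for f
  proof -
    have F: "(\<lambda>p. c (snd p) * q (\<phi> (snd p)) (\<lambda>v. pc (fst p) v f)) \<in> cfun"
      using kernel_slice_right[OF compact_space E_is_kernel kernel_cfun[OF pc_kernel f]]
      by (intro cfun_mult cfun_compose[OF B_cfun[OF c]] continuous_intros) (simp add: case_prod_unfold)
    define h where "h x = \<mu> (\<lambda>y. c y * q (\<phi> y) (\<lambda>v. pc x v f))" for x
    have h: "h \<in> cfun"
      using measure_slice_right[OF compact_space \<mu>_radon F] by (simp add: h_def[abs_def])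
    have "E h x = \<mu> (\<lambda>y. q (\<phi> x) (\<lambda>u. c y * q (\<phi> y) (\<lambda>v. pc u v f)))" for x
      using fubini[OF compact_space compact_space q_radon \<mu>_radon F] by (simp add: h_def[abs_def])
    then have "E h x = \<mu> (\<lambda>y. c y * conv pc (q (\<phi> x)) (q (\<phi> y)) f)" for x
      by (simp add: radon_scale[OF q_radon conv_slice_cfun[OF q_radon f]] conv_q)
    moreover have "\<mu> (\<lambda>y. c y * pc x y f) = h x" for x
      unfolding h_def by (rule \<mu>_mult_E[OF c pc_cfun_right[OF f]])
    ultimately show ?thesis
      using \<mu>_mult_E[OF a h] by simp
  qed
  show ?thesis
    unfolding averaged[OF f] averaged[OF E_cfun[OF f]] conv_q_invariant[OF f] by simp
qed

text \<open>
  By \<open>translation_adjoint\<close>, this function \<open>g\<close> is the density of the convolution of the measures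
  \<open>a (dag x) d\<mu>(x)\<close> and \<open>c d\<mu>\<close>. That measure is invariant under the symmetric operator \<open>E\<close>, so
  \<open>g\<close> and \<open>E g\<close> have the same integrals against all continuous functions.
\<close>

lemma B_average_of_translates:
  assumes a: "a \<in> B" and c: "c \<in> B"
  shows "(\<lambda>y. \<mu> (\<lambda>x. a x * pc x y c)) \<in> B"
proof -
  note ac = B_cfun[OF a] and cc = B_cfun[OF c]
  define g where "g y = \<mu> (\<lambda>x. a x * pc x y c)" for y
  have F: "(\<lambda>p. a (fst p) * pc (fst p) (snd p) c) \<in> cfun"
    by (intro cfun_mult kernel_cfun[OF pc_kernel] cc cfun_compose[OF ac] continuous_intros)
  have g: "g \<in> cfun"
    using measure_slice_left[OF compact_space \<mu>_radon F] by (simp add: g_def[abs_def])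
  have density: "\<mu> (\<lambda>y. g y * f y) = \<mu> (\<lambda>x. a (dag x) * \<mu> (\<lambda>y. c y * pc x y f))"
    if f: "f \<in> cfun" for f
  proof -
    have Ff: "(\<lambda>p. a (fst p) * (pc (fst p) (snd p) c * f (snd p))) \<in> cfun"
      by (intro cfun_mult kernel_cfun[OF pc_kernel] cc cfun_compose[OF ac] cfun_compose[OF f]
          continuous_intros)
    have "\<mu> (\<lambda>y. g y * f y) = \<mu> (\<lambda>y. \<mu> (\<lambda>x. a x * (pc x y c * f y)))"
    proof -
      have "g y * f y = \<mu> (\<lambda>x. a x * (pc x y c * f y))" for y
        using radon_scale_right[OF \<mu>_radon cfun_mult[OF ac pc_cfun_left[OF cc]], of y "f y"]
        by (simp add: g_def mult.assoc)
      then show ?thesis by simp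
    qed
    also have "\<dots> = \<mu> (\<lambda>x. \<mu> (\<lambda>y. a x * (pc x y c * f y)))"
      using fubini[OF compact_space compact_space \<mu>_radon \<mu>_radon Ff] by simp
    also have "\<dots> = \<mu> (\<lambda>x. a x * \<mu> (\<lambda>y. pc x y c * f y))"
      by (simp add: radon_scale[OF \<mu>_radon cfun_mult[OF pc_cfun_right[OF cc] f]])
    also have "\<dots> = \<mu> (\<lambda>x. a x * \<mu> (\<lambda>y. c y * pc (dag x) y f))"
      by (simp add: translation_adjoint[OF cc f])
    also have "\<dots> = \<mu> (\<lambda>x. a (dag x) * \<mu> (\<lambda>y. c y * pc x y f))"
    proof -
      have "(\<lambda>p. c (snd p) * pc (fst p) (snd p) f) \<in> cfun"
        by (intro cfun_mult kernel_cfun[OF pc_kernel] f cfun_compose[OF cc] continuous_intros)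
      from measure_slice_right[OF compact_space \<mu>_radon this]
      have "(\<lambda>x. a (dag x) * \<mu> (\<lambda>y. c y * pc x y f)) \<in> cfun"
        by (intro cfun_mult cfun_dag ac) simp
      from \<mu>_dag[OF this] show ?thesis by (simp add: dag_dag)
    qed
    finally show ?thesis .
  qed
  have "\<mu> (\<lambda>y. (g y - E g y) * f y) = 0" if f: "f \<in> cfun" for f
  proof -
    have "\<mu> (\<lambda>y. g y * f y) = \<mu> (\<lambda>y. g y * E f y)"
      unfolding density[OF f] density[OF E_cfun[OF f]]
      by (rule B_measures_conv_invariant[OF B_dag[OF a] c f])
    then have "\<mu> (\<lambda>y. g y * f y) = \<mu> (\<lambda>y. E g y * f y)"
      by (simp add: \<mu>_E_symmetric[OF g f])
    then show ?thesis
      by (simp add: left_diff_distrib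
          radon_diff[OF \<mu>_radon cfun_mult[OF g f] cfun_mult[OF E_cfun[OF g] f]])
  qed
  from \<mu>_definite[OF cfun_diff[OF g E_cfun[OF g]] this] have "g = E g" by (simp add: fun_eq_iff)
  then show ?thesis using E_B[OF g] by (simp add: g_def[abs_def])
qed

text \<open>
  The value in question is \<open>E V x\<close> for \<open>V u = \<integral> c (u * y) d\<nu>(y)\<close>. By symmetry of \<open>E\<close>, testing
  \<open>E V\<close> against \<open>f\<close> means testing \<open>V\<close> against \<open>E f \<in> B\<close>, which integrates a function in \<open>B\<close>
  against \<open>\<nu>\<close>.
\<close>

lemma conv_q_null:
  assumes \<nu>: "\<nu> \<in> radon_measures" and null: "\<And>b. b \<in> B \<Longrightarrow> \<nu> b = 0" and c: "c \<in> B"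
  shows "conv pc (q (\<phi> x)) \<nu> c = 0"
proof -
  note cc = B_cfun[OF c]
  define V where "V u = \<nu> (\<lambda>y. pc u y c)" for u
  have V: "V \<in> cfun" unfolding V_def by (rule conv_slice_cfun[OF \<nu> cc])
  have "\<mu> (\<lambda>x. E V x * f x) = 0" if f: "f \<in> cfun" for f
  proof -
    note Ef = E_cfun[OF f]
    have "(\<lambda>p. E f (fst p) * pc (fst p) (snd p) c) \<in> cfun"
      by (intro cfun_mult kernel_cfun[OF pc_kernel] cc cfun_compose[OF Ef] continuous_intros)
    from fubini[OF compact_space compact_space \<mu>_radon \<nu> this]
    have "\<mu> (\<lambda>x. E f x * V x) = \<nu> (\<lambda>y. \<mu> (\<lambda>x. E f x * pc x y c))"
      by (simp add: V_def radon_scale[OF \<nu> pc_cfun_right[OF cc]])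
    also have "\<dots> = 0"
      by (rule null[OF B_average_of_translates[OF E_B[OF f] c]])
    finally have "\<mu> (\<lambda>x. V x * E f x) = 0" by (simp add: mult.commute)
    then show ?thesis by (simp only: \<mu>_E_symmetric[OF V f])
  qed
  from \<mu>_definite[OF E_cfun[OF V] this] show ?thesis
    by (simp add: conv_def comult_def V_def[abs_def])
qed

lemma q_consistent: "phi_consistent pc \<phi> (q y)"
proof -
  obtain x where y: "y = \<phi> x" using \<phi>_surj by (metis surjD)
  have "conv pc (q y) \<nu> c = 0 \<and> conv pc \<nu> (q y) c = 0"
    if \<nu>: "\<nu> \<in> radon_measures" "\<forall>b\<in>B. \<nu> b = 0" and c: "c \<in> B" for \<nu> c
  proof -
    define \<nu>' where "\<nu>' = pushforward dag \<nu>"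
    have \<nu>': "\<nu>' \<in> radon_measures" "\<And>b. b \<in> B \<Longrightarrow> \<nu>' b = 0"
      using pushforward_dag_radon[OF \<nu>(1)] \<nu>(2) B_dag
      by (auto simp: \<nu>'_def pushforward_def comp_def)
    note c' = B_cfun[OF B_dag[OF c]]
    have "conv pc \<nu> (q (\<phi> x)) c = conv pc (pushforward dag (q (\<phi> x))) \<nu>' (\<lambda>z. c (dag z))"
      using conv_dag[OF \<nu>(1) q_radon c'] by (simp add: \<nu>'_def dag_dag)
    also have "\<dots> = conv pc (q (\<phi> (dag x))) \<nu>' (\<lambda>z. c (dag z))"
      using q_dag_invariant[OF conv_slice_cfun[OF \<nu>'(1) c']]
      by (simp add: conv_def comult_def pushforward_def comp_def)
    also have "\<dots> = 0" by (rule conv_q_null[OF \<nu>' B_dag[OF c]])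
    finally show ?thesis
      using conv_q_null[OF \<nu>(1) _ c] \<nu>(2) by (simp add: y)
  qed
  then show ?thesis by (simp add: phi_consistent_iff q_radon)
qed

end

end

section \<open>Consistency and the expectation\<close>

theorem proposition2p7:
  fixes pc :: "'q::t2_space \<Rightarrow> 'q \<Rightarrow> 'q functional"
    and dag :: "'q \<Rightarrow> 'q"
    and e :: 'q
    and \<mu> :: "'q functional"
    and \<phi> :: "'q \<Rightarrow> 'y::t2_space"
    and q :: "'y \<Rightarrow> 'q functional"
    and P :: "('q \<Rightarrow> complex) \<Rightarrow> ('q \<Rightarrow> complex)"
  assumes hypergroup: "compact_DJS_hypergroup pc dag e"
    and haar: "haar_measure pc \<mu>"
    and Y_compact: "compact (UNIV :: 'y set)"
    and orbital: "orbital_mapping \<phi>"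
    and a: "\<phi> -` {\<phi> e} = {e}"
    and b: "\<forall>A\<in>orbits \<phi>. dag ` A \<in> orbits \<phi>"
    and c: "\<forall>y. probability_measure (q y) \<and> msupport (q y) \<subseteq> \<phi> -` {y}"
    and P_def: "P = (\<lambda>f x. q (\<phi> x) f)"
  shows "((\<forall>y. phi_consistent pc \<phi> (q y)) \<longrightarrow>
      conditional_expectation (orbit_subalgebra \<phi>) P \<and>
      hypotheses_H pc dag e \<mu> (orbit_subalgebra \<phi>) P) \<and>
    (conditional_expectation (orbit_subalgebra \<phi>) P \<and>
      hypotheses_H pc dag e \<mu> (orbit_subalgebra \<phi>) P \<longrightarrow>
      (\<forall>y. phi_consistent pc \<phi> (q y)))"
proof -
  have "orbital_hypergroup pc dag e \<mu> \<phi> q"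
    using hypergroup haar orbital a b c
    by (simp add: orbital_hypergroup_def orbital_hypergroup_axioms_def
        compact_hypergroup_with_haar_def compact_hypergroup_with_haar_axioms_def)
  then interpret orbital_hypergroup pc dag e \<mu> \<phi> q .
  show ?thesis
    unfolding P_def
  proof (intro conjI impI)
    assume "\<forall>y. phi_consistent pc \<phi> (q y)"
    then have cons: "phi_consistent pc \<phi> (q y)" for y by simp
    show "conditional_expectation B E"
      by (rule conditional_expectation_E[OF E_continuous[OF cons]])
    show "hypotheses_H pc dag e \<mu> B E"
      by (rule hypotheses_H_E[OF cons])
  next
    assume "conditional_expectation B E \<and> hypotheses_H pc dag e \<mu> B E"
    then show "\<forall>y. phi_consistent pc \<phi> (q y)"
      using q_consistent by blast
  qed
qed

end
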